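(* Let $G$ be a graph. Then $\mathrm{smt}(G)=\mathrm{rank}(G)$.
   Context: $G=(V,E)$ is a finite simple undirected graph with $V=[m]$. $\mathbb{S}_m$ is the space of real symmetric $m\times m$ matrices; $L_G=\{K\in\mathbb{S}_m: K_{ij}=0 \text{ whenever } i\ne j \text{ and } ij\notin E\}$ and $\Pi_G$ is the orthogonal projection of $\mathbb{S}_m$ onto $L_G$. Given $n$ observations forming the columns... more precisely a data matrix $P\in\mathbb{R}^{n\times m}$ with sample covariance $\Sigma_0=P^TP$, the score matching estimator (SME) exists if the linear equation $\tfrac12\Pi_G(K\Sigma_0^T+\Sigma_0K^T)=I_m$ has a unique solution $K\in L_G$. $G$ is $n$-estimable if the SME exists with probability one (for Lebesgue-almost all $P\in\mathbb{R}^{n\times m}$); the score matching threshold $\mathrm{smt}(G)$ is the minimal $n$ such that $G$ is $n$-estimable. $Sym(m,n)$ is the set of symmetric $m\times m$ matrices of rank at most $n$, $\phi_G(\Sigma)=(\sigma_{ii})_{i\in V}\oplus(\sigma_{ij})_{ij\in E}$, and $\mathrm{rank}(G)$ is the smallest $n$ with $\dim\phi_G(Sym(m,n))=\#V+\#E$. *)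

theory Defs
  imports
    "HOL-Analysis.Analysis"
    "Jordan_Normal_Form.DL_Rank"
begin

hide_const (open) Finite_Cartesian_Product.mat Finite_Cartesian_Product.transpose
  Cartesian_Space.rank
no_notation Finite_Cartesian_Product.vec_nth (infixl \<open>$\<close> 90)

(* Matrices are 0-indexed here, so the vertex set [m] is {..<m}; an edge ij is the set {i, j}. *)

definition simple_graph :: "nat \<Rightarrow> nat set set \<Rightarrow> bool" where
  "simple_graph m E \<longleftrightarrow> E \<subseteq> {{i, j} | i j. i < m \<and> j < m \<and> i \<noteq> j}"

definition sym_mats :: "nat \<Rightarrow> real mat set" where
  "sym_mats m = {A \<in> carrier_mat m m. A\<^sup>T = A}"

definition L_space :: "nat \<Rightarrow> nat set set \<Rightarrow> real mat set" where
  "L_space m E = {K \<in> sym_mats m. \<forall>i<m. \<forall>j<m. i \<noteq> j \<and> {i, j} \<notin> E \<longrightarrow> K $$ (i, j) = 0}"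

definition frob_inner :: "nat \<Rightarrow> real mat \<Rightarrow> real mat \<Rightarrow> real" where
  "frob_inner m A B = (\<Sum>i<m. \<Sum>j<m. A $$ (i, j) * B $$ (i, j))"

definition proj_L :: "nat \<Rightarrow> nat set set \<Rightarrow> real mat \<Rightarrow> real mat" where
  "proj_L m E A = (THE B. B \<in> L_space m E \<and> (\<forall>K \<in> L_space m E. frob_inner m (A - B) K = 0))"

(* The description is well defined on symmetric matrices, with the expected entries. *)
lemma proj_L_eq:
  assumes A: "A \<in> sym_mats m"
  shows "proj_L m E A = mat m m (\<lambda>(i, j). if i = j \<or> {i, j} \<in> E then A $$ (i, j) else 0)"
    (is "_ = ?B")
proof -
  have Ac: "A \<in> carrier_mat m m" and At: "A\<^sup>T = A" using A by (auto simp: sym_mats_def)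
  have Aji: "A $$ (j, i) = A $$ (i, j)" if "i < m" "j < m" for i j
    using At Ac that by (metis carrier_matD index_transpose_mat(1))
  have BL: "?B \<in> L_space m E"
    unfolding L_space_def sym_mats_def
    by (auto intro!: eq_matI simp: insert_commute Aji)
  have orth: "frob_inner m (A - ?B) K = 0" if "K \<in> L_space m E" for K
    unfolding frob_inner_def using that Ac
    by (intro sum.neutral ballI) (auto simp: L_space_def)
  show ?thesis unfolding proj_L_def
  proof (rule the_equality)
    show "?B \<in> L_space m E \<and> (\<forall>K \<in> L_space m E. frob_inner m (A - ?B) K = 0)"
      using BL orth by blast
  next
    fix B assume B: "B \<in> L_space m E \<and> (\<forall>K \<in> L_space m E. frob_inner m (A - B) K = 0)"
    have Bc: "B \<in> carrier_mat m m" and Bt: "B\<^sup>T = B"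
      using B by (auto simp: L_space_def sym_mats_def)
    have Bji: "B $$ (j, i) = B $$ (i, j)" if "i < m" "j < m" for i j
      using Bt Bc that by (metis carrier_matD index_transpose_mat(1))
    let ?D = "?B - B"
    have D: "?D \<in> L_space m E"
      using BL B Bc unfolding L_space_def sym_mats_def
      by (auto intro!: eq_matI simp: insert_commute Aji Bji)
    have "frob_inner m (A - B) ?D - frob_inner m (A - ?B) ?D = frob_inner m ?D ?D"
      unfolding frob_inner_def sum_subtractf[symmetric] using Ac Bc
      by (intro sum.cong refl) (auto simp: algebra_simps)
    then have "frob_inner m ?D ?D = 0" using B D orth by simp
    then have "\<forall>i<m. \<forall>j<m. ?D $$ (i, j) = 0"
      unfolding frob_inner_def
      by (subst (asm) sum_nonneg_eq_0_iff; simp add: sum_nonneg sum_nonneg_eq_0_iff)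
    then show "B = ?B" using Bc by (intro eq_matI) auto
  qed
qed

definition sme_exists :: "nat \<Rightarrow> nat set set \<Rightarrow> real mat \<Rightarrow> bool" where
  "sme_exists m E P \<longleftrightarrow>
     (let S = P\<^sup>T * P
      in \<exists>!K. K \<in> L_space m E \<and> (1/2) \<cdot>\<^sub>m proj_L m E (K * S\<^sup>T + S * K\<^sup>T) = 1\<^sub>m m)"

(* The product of the one-dimensional Lebesgue measures is Lebesgue measure on n x m matrices. *)
definition estimable :: "nat \<Rightarrow> nat set set \<Rightarrow> nat \<Rightarrow> bool" where
  "estimable m E n \<longleftrightarrow>
     (AE p in PiM ({..<n} \<times> {..<m}) (\<lambda>_. lborel :: real measure). sme_exists m E (mat n m p))"

definition smt :: "nat \<Rightarrow> nat set set \<Rightarrow> nat" where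
  "smt m E = (LEAST n. estimable m E n)"

(* Affine space over the reals with coordinates indexed by I is I \<rightarrow>\<^sub>E UNIV. *)

inductive_set poly_funs :: "'i set \<Rightarrow> (('i \<Rightarrow> real) \<Rightarrow> real) set" for I where
  const: "(\<lambda>_. c) \<in> poly_funs I"
| coord: "i \<in> I \<Longrightarrow> (\<lambda>x. x i) \<in> poly_funs I"
| add: "f \<in> poly_funs I \<Longrightarrow> g \<in> poly_funs I \<Longrightarrow> (\<lambda>x. f x + g x) \<in> poly_funs I"
| mult: "f \<in> poly_funs I \<Longrightarrow> g \<in> poly_funs I \<Longrightarrow> (\<lambda>x. f x * g x) \<in> poly_funs I"

definition zariski_closed :: "'i set \<Rightarrow> ('i \<Rightarrow> real) set \<Rightarrow> bool" where
  "zariski_closed I Z \<longleftrightarrow> (\<exists>F \<subseteq> poly_funs I. Z = {x \<in> I \<rightarrow>\<^sub>E UNIV. \<forall>f \<in> F. f x = 0})"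

definition zariski_irreducible :: "'i set \<Rightarrow> ('i \<Rightarrow> real) set \<Rightarrow> bool" where
  "zariski_irreducible I Z \<longleftrightarrow> Z \<noteq> {} \<and>
     (\<forall>A B. zariski_closed I A \<and> zariski_closed I B \<and> Z \<subseteq> A \<union> B \<longrightarrow> Z \<subseteq> A \<or> Z \<subseteq> B)"

(* Krull dimension of the Zariski closure: the supremum of the lengths k of strict chains
   Z 0 < ... < Z k of irreducible closed subsets. The empty set gets 0 instead of minus infinity. *)
definition alg_dim :: "'i set \<Rightarrow> ('i \<Rightarrow> real) set \<Rightarrow> enat" where
  "alg_dim I S = Sup {enat k | k. \<exists>Z :: nat \<Rightarrow> ('i \<Rightarrow> real) set.
     (\<forall>i\<le>k. zariski_closed I (Z i) \<and> zariski_irreducible I (Z i) \<and> Z i \<subseteq> zariski_closed I hull S) \<and>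
     (\<forall>i<k. Z i \<subset> Z (Suc i))}"

definition sym_rank_le :: "nat \<Rightarrow> nat \<Rightarrow> real mat set" where
  "sym_rank_le m n = {A \<in> sym_mats m. vec_space.rank m A \<le> n}"

definition coords :: "nat \<Rightarrow> nat set set \<Rightarrow> (nat + nat set) set" where
  "coords m E = {..<m} <+> E"

(* On an edge e = {i, j} the value is the entry (i, j), unambiguous since matrices are symmetric. *)
definition phi :: "nat \<Rightarrow> nat set set \<Rightarrow> real mat \<Rightarrow> (nat + nat set) \<Rightarrow> real" where
  "phi m E A = (\<lambda>c \<in> coords m E. case c of Inl i \<Rightarrow> A $$ (i, i) | Inr e \<Rightarrow> A $$ (Min e, Max e))"

definition graph_rank :: "nat \<Rightarrow> nat set set \<Rightarrow> nat" where
  "graph_rank m E =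
     (LEAST n. alg_dim (coords m E) (phi m E ` sym_rank_le m n) = enat (card {..<m} + card E))"

end

theory Submission
  imports Defs
begin

text \<open>Call a data matrix \<open>P\<close> regular if no nonzero \<open>K\<close> in \<open>L_space\<close> satisfies \<open>P * K = 0\<close>. The
  inner product of \<open>K\<close> with \<open>S * K + K * S\<close>, \<open>S = P\<^sup>T * P\<close>, is twice the squared norm of \<open>P * K\<close>, so the
  estimator exists iff \<open>P\<close> is regular, and regularity makes \<open>P \<mapsto> phi (P\<^sup>T * P)\<close> a submersion at \<open>P\<close>.
  A polynomial map that is a submersion at one point has Zariski dense image, and a polynomial map
  with dense image is a submersion at a generic point. The second fact is applied to
  \<open>(P, M) \<mapsto> phi (P\<^sup>T * (M + M\<^sup>T) * P)\<close>, which parametrises the matrices of rank at most \<open>n\<close> and is a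
  submersion only where \<open>P\<close> is regular. Finally, density is equivalent to full dimension, because
  polynomials separating the members of a chain of irreducible sets are algebraically independent.\<close>

section \<open>Polynomial functions\<close>

lemma poly_funs_cong:
  assumes "f \<in> poly_funs I" "\<And>i. i \<in> I \<Longrightarrow> x i = y i"
  shows "f x = f y"
  using assms by induction auto

lemma poly_funs_diff:
  assumes "f \<in> poly_funs I" "g \<in> poly_funs I"
  shows "(\<lambda>x. f x - g x) \<in> poly_funs I"
  using poly_funs.add[OF assms(1) poly_funs.mult[OF poly_funs.const[of "-1"] assms(2)]] by simp

lemma poly_funs_sum:
  assumes "\<And>a. a \<in> A \<Longrightarrow> f a \<in> poly_funs I"
  shows "(\<lambda>x. \<Sum>a\<in>A. f a x) \<in> poly_funs I"
  using assms by (induction A rule: infinite_finite_induct) (auto intro: poly_funs.intros)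

lemma poly_funs_prod:
  assumes "\<And>a. a \<in> A \<Longrightarrow> f a \<in> poly_funs I"
  shows "(\<lambda>x. \<Prod>a\<in>A. f a x) \<in> poly_funs I"
  using assms by (induction A rule: infinite_finite_induct) (auto intro: poly_funs.intros)

lemma poly_funs_power:
  assumes "f \<in> poly_funs I"
  shows "(\<lambda>x. f x ^ k) \<in> poly_funs I"
  using assms by (induction k) (auto intro: poly_funs.intros)

lemma poly_funs_compose:
  assumes "f \<in> poly_funs I" "\<And>i. i \<in> I \<Longrightarrow> g i \<in> poly_funs J"
  shows "(\<lambda>x. f (\<lambda>i. g i x)) \<in> poly_funs J"
  using assms by induction (auto intro: poly_funs.intros)

lemma poly_funs_fix_coord:
  assumes "f \<in> poly_funs (insert i I)"
  shows "(\<lambda>x. f (x(i := c))) \<in> poly_funs I"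
  unfolding fun_upd_def
proof (rule poly_funs_compose[OF assms])
  show "(\<lambda>x. if j = i then c else x j) \<in> poly_funs I" if "j \<in> insert i I" for j
    using that by (cases "j = i") (auto intro: poly_funs.intros)
qed

lemma poly_funs_tendsto:
  assumes "f \<in> poly_funs I" "\<And>i. i \<in> I \<Longrightarrow> ((\<lambda>s. y s i) \<longlongrightarrow> v i) F"
  shows "((\<lambda>s. f (y s)) \<longlongrightarrow> f v) F"
  using assms by induction (auto intro: tendsto_add tendsto_mult)

lemma poly_funs_curve:
  assumes "f \<in> poly_funs I" "\<And>i. i \<in> I \<Longrightarrow> \<exists>p. \<forall>s. c s i = poly p s"
  shows "\<exists>p. \<forall>s. f (c s) = poly p s"
  using assms
proof induction
  case (const c)
  show ?case by (rule exI[of _ "[:c:]"]) simp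
next
  case (add f g)
  then obtain p q where "\<forall>s. f (c s) = poly p s" "\<forall>s. g (c s) = poly q s" by blast
  then show ?case by (intro exI[of _ "p + q"]) simp
next
  case (mult f g)
  then obtain p q where "\<forall>s. f (c s) = poly p s" "\<forall>s. g (c s) = poly q s" by blast
  then show ?case by (intro exI[of _ "p * q"]) simp
qed auto

lemma poly_funs_line:
  assumes "f \<in> poly_funs I"
  obtains p where "\<And>s. f (\<lambda>i. x i + s * w i) = poly p s"
proof -
  have "\<exists>p. \<forall>s. x i + s * w i = poly p s" for i
    by (rule exI[of _ "[:x i, w i:]"]) simp
  then show ?thesis using poly_funs_curve[OF assms, of "\<lambda>s i. x i + s * w i"] that by blast
qed

lemma poly_funs_common_nonzero:
  assumes f: "f \<in> poly_funs I" "f x \<noteq> 0" and g: "g \<in> poly_funs I" "g y \<noteq> 0"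
  shows "\<exists>z. f z \<noteq> 0 \<and> g z \<noteq> 0"
proof -
  let ?z = "\<lambda>s i. x i + s * (y i - x i)"
  obtain p where p: "\<And>s. f (?z s) = poly p s" using poly_funs_line[OF f(1)] by metis
  obtain q where q: "\<And>s. g (?z s) = poly q s" using poly_funs_line[OF g(1)] by metis
  have "p \<noteq> 0" using p[of 0] f(2) by auto
  moreover have "q \<noteq> 0" using q[of 1] g(2) by auto
  ultimately have "p * q \<noteq> 0" by simp
  then obtain s where "poly (p * q) s \<noteq> 0" using poly_all_0_iff_0 by blast
  then show ?thesis by (intro exI[of _ "?z s"]) (simp add: p q)
qed

section \<open>Degrees in single variables\<close>

definition degree_in_le :: "'i \<Rightarrow> nat \<Rightarrow> (('i \<Rightarrow> real) \<Rightarrow> real) \<Rightarrow> bool" where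
  "degree_in_le i d f \<longleftrightarrow> (\<forall>x. \<exists>p. degree p \<le> d \<and> (\<forall>s. f (x(i := s)) = poly p s))"

lemma degree_in_leE:
  assumes "degree_in_le i d f"
  obtains p where "degree p \<le> d" "\<And>s. f (x(i := s)) = poly p s"
  using assms unfolding degree_in_le_def by blast

lemma degree_in_le_mono: "degree_in_le i d f \<Longrightarrow> d \<le> e \<Longrightarrow> degree_in_le i e f"
  unfolding degree_in_le_def by (meson order_trans)

lemma degree_in_le_const: "degree_in_le i d (\<lambda>_. c)"
  unfolding degree_in_le_def by (auto intro!: exI[of _ "[:c:]"])

lemma degree_in_le_coord: "degree_in_le i 1 (\<lambda>x. x j)"
  unfolding degree_in_le_def
proof
  fix x :: "_ \<Rightarrow> real"
  show "\<exists>p. degree p \<le> 1 \<and> (\<forall>s. (x(i := s)) j = poly p s)"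
    by (rule exI[of _ "if j = i then [:0, 1:] else [:x j:]"]) auto
qed

lemma degree_in_le_add:
  assumes "degree_in_le i d f" "degree_in_le i d g"
  shows "degree_in_le i d (\<lambda>x. f x + g x)"
  unfolding degree_in_le_def
proof
  fix x
  obtain p q where "degree p \<le> d" "\<And>s. f (x(i := s)) = poly p s"
    "degree q \<le> d" "\<And>s. g (x(i := s)) = poly q s"
    by (metis assms degree_in_leE)
  then show "\<exists>p. degree p \<le> d \<and> (\<forall>s. f (x(i := s)) + g (x(i := s)) = poly p s)"
    by (intro exI[of _ "p + q"]) (auto intro: degree_add_le)
qed

lemma degree_in_le_mult:
  assumes "degree_in_le i d f" "degree_in_le i e g"
  shows "degree_in_le i (d + e) (\<lambda>x. f x * g x)"
  unfolding degree_in_le_def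
proof
  fix x
  obtain p q where "degree p \<le> d" "\<And>s. f (x(i := s)) = poly p s"
    "degree q \<le> e" "\<And>s. g (x(i := s)) = poly q s"
    by (metis assms degree_in_leE)
  then show "\<exists>p. degree p \<le> d + e \<and> (\<forall>s. f (x(i := s)) * g (x(i := s)) = poly p s)"
    by (intro exI[of _ "p * q"]) (auto intro: order_trans[OF degree_mult_le])
qed

lemma degree_in_le_sum:
  assumes "\<And>a. a \<in> A \<Longrightarrow> degree_in_le i d (f a)"
  shows "degree_in_le i d (\<lambda>x. \<Sum>a\<in>A. f a x)"
  using assms by (induction A rule: infinite_finite_induct)
    (auto intro: degree_in_le_const degree_in_le_add)

lemma degree_in_le_prod:
  assumes "\<And>a. a \<in> A \<Longrightarrow> degree_in_le i d (f a)"
  shows "degree_in_le i (card A * d) (\<lambda>x. \<Prod>a\<in>A. f a x)"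
  using assms
proof (induction A rule: infinite_finite_induct)
  case (insert a A)
  then have "degree_in_le i (d + card A * d) (\<lambda>x. f a x * (\<Prod>a\<in>A. f a x))"
    by (intro degree_in_le_mult) auto
  then show ?case using insert by simp
qed (auto intro: degree_in_le_const)

lemma poly_funs_degree_in_le:
  assumes "f \<in> poly_funs I"
  shows "\<exists>d. \<forall>i. degree_in_le i d f"
  using assms
proof induction
  case (add f g)
  then obtain d e where "\<forall>i. degree_in_le i d f" "\<forall>i. degree_in_le i e g" by blast
  then show ?case
    by (intro exI[of _ "max d e"] allI degree_in_le_add)
       (blast intro: degree_in_le_mono max.cobounded1 max.cobounded2)+
next
  case (mult f g)
  then obtain d e where "\<forall>i. degree_in_le i d f" "\<forall>i. degree_in_le i e g" by blast
  then show ?case by (intro exI[of _ "d + e"] allI degree_in_le_mult) blast+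
next
  case (coord j)
  show ?case by (intro exI[of _ 1] allI degree_in_le_coord)
qed (auto intro: degree_in_le_const)

lemma degree_in_le_card_roots:
  assumes deg: "degree_in_le i d f"
    and roots: "d < card S" "\<And>s. s \<in> S \<Longrightarrow> f (x(i := s)) = 0"
  shows "f x = 0"
proof -
  obtain p where p: "degree p \<le> d" "\<And>s. f (x(i := s)) = poly p s"
    using degree_in_leE[OF deg] by blast
  have "p = 0"
  proof (rule ccontr)
    assume "p \<noteq> 0"
    have "card S \<le> card {s. poly p s = 0}"
      using roots(2) p(2) by (intro card_mono poly_roots_finite \<open>p \<noteq> 0\<close>) auto
    also have "\<dots> \<le> d" using card_poly_roots_bound[OF \<open>p \<noteq> 0\<close>] p(1) by linarith
    finally show False using roots(1) by simp
  qed
  then show ?thesis using p(2)[of "x i"] by simp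
qed

lemma degree_in_le_zero_on_grid:
  assumes "finite I" and "\<And>i. i \<in> I \<Longrightarrow> degree_in_le i d f" and card: "d < card S"
    and zero: "\<And>x. (\<And>i. i \<in> I \<Longrightarrow> x i \<in> S) \<Longrightarrow> f x = 0"
  shows "f x = 0"
  using assms(1,2) zero
proof (induction I arbitrary: x)
  case (insert i I)
  show ?case
  proof (rule insert.IH)
    fix x assume "\<And>j. j \<in> I \<Longrightarrow> x j \<in> S"
    then have "f (x(i := s)) = 0" if "s \<in> S" for s using that by (intro insert.prems(2)) auto
    then show "f x = 0" by (rule degree_in_le_card_roots[OF insert.prems(1)[OF insertI1] card])
  qed (use insert.prems(1) in auto)
qed simp

section \<open>Splitting off powers of a coordinate\<close>

lemma poly_funs_split_coord:
  assumes "f \<in> poly_funs I" "i \<in> I"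
  shows "\<exists>g\<in>poly_funs I. \<forall>x. f x = f (x(i := 0)) + x i * g x"
  using assms
proof induction
  case (const c)
  show ?case by (rule bexI[of _ "\<lambda>_. 0"]) (auto intro: poly_funs.const)
next
  case (coord j)
  show ?case
    by (rule bexI[of _ "\<lambda>_. of_bool (j = i)"]) (auto intro: poly_funs.const)
next
  case (add f g)
  then obtain f' g' where f': "f' \<in> poly_funs I" "\<And>x. f x = f (x(i := 0)) + x i * f' x"
    and g': "g' \<in> poly_funs I" "\<And>x. g x = g (x(i := 0)) + x i * g' x" by blast
  have "f x + g x = f (x(i := 0)) + g (x(i := 0)) + x i * (f' x + g' x)" for x
    using f'(2)[of x] g'(2)[of x] by (simp add: distrib_left)
  then show ?case by (intro bexI[of _ "\<lambda>x. f' x + g' x"] poly_funs.add f'(1) g'(1) allI)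
next
  case (mult f g)
  then obtain f' g' where f': "f' \<in> poly_funs I" "\<And>x. f x = f (x(i := 0)) + x i * f' x"
    and g': "g' \<in> poly_funs I" "\<And>x. g x = g (x(i := 0)) + x i * g' x" by blast
  have "(\<lambda>x. f (x(i := 0)) * g' x + f' x * g x) \<in> poly_funs I"
    using poly_funs_fix_coord[of f i I 0] mult.hyps mult.prems f'(1) g'(1)
    by (auto intro!: poly_funs.add poly_funs.mult simp: insert_absorb)
  moreover have "f x * g x = f (x(i := 0)) * g (x(i := 0)) +
      x i * (f (x(i := 0)) * g' x + f' x * g x)" for x
  proof -
    have "f x * g x = f (x(i := 0)) * g x + x i * (f' x * g x)"
      using arg_cong[OF f'(2)[of x], of "\<lambda>a. a * g x"] by (simp add: distrib_right)
    also have "f (x(i := 0)) * g x = f (x(i := 0)) * g (x(i := 0)) + x i * (f (x(i := 0)) * g' x)"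
      using arg_cong[OF g'(2)[of x], of "\<lambda>a. f (x(i := 0)) * a"] by (simp add: distrib_left)
    finally show ?thesis by (simp add: distrib_left)
  qed
  ultimately show ?case by (intro bexI[of _ "\<lambda>x. f (x(i := 0)) * g' x + f' x * g x"] allI)
qed

lemma degree_in_le_cancel_coord:
  assumes g: "g \<in> poly_funs I" and deg: "degree_in_le i (Suc d) (\<lambda>x. x i * g x)"
  shows "degree_in_le i d g"
  unfolding degree_in_le_def
proof
  fix x
  obtain p where p: "degree p \<le> Suc d" "\<And>s. s * g (x(i := s)) = poly p s"
    using degree_in_leE[OF deg, of x] by auto
  obtain q where q: "\<And>s. g (x(i := s)) = poly q s"
    using poly_funs_degree_in_le[OF g] degree_in_leE by meson
  have "poly (pCons 0 q) = poly p" by (rule ext) (simp add: q[symmetric] p(2)[symmetric])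
  then have "pCons 0 q = p" by (simp only: poly_eq_poly_eq_iff)
  then have "degree q \<le> d" using p(1) by (auto simp: degree_pCons_eq_if split: if_splits)
  then show "\<exists>q. degree q \<le> d \<and> (\<forall>s. g (x(i := s)) = poly q s)" using q by blast
qed

lemma degree_in_le_0_const:
  assumes "degree_in_le i 0 f"
  shows "f (x(i := s)) = f x"
proof -
  obtain p where p: "degree p = 0" "\<And>s. f (x(i := s)) = poly p s"
    using degree_in_leE[OF assms, of x] by auto
  obtain a where "p = [:a:]" using p(1) by (rule degree_eq_zeroE)
  then show ?thesis using p(2)[of s] p(2)[of "x i"] by simp
qed

lemma poly_funs_factor_coord:
  assumes f: "f \<in> poly_funs I" "f z \<noteq> 0" and i: "i \<in> I"
  obtains g e y where "g \<in> poly_funs I" "\<forall>x. f x = x i ^ e * g x" "g (y(i := 0)) \<noteq> 0"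
proof -
  have "\<exists>e g. g \<in> poly_funs I \<and> (\<forall>x. f x = x i ^ e * g x) \<and> (\<exists>y. g (y(i := 0)) \<noteq> 0)"
    if "degree_in_le i d f" for d
    using f that
  proof (induction d arbitrary: f)
    case 0
    then have "f (z(i := 0)) \<noteq> 0" using degree_in_le_0_const[of i f z 0] by simp
    moreover have "\<forall>x. f x = x i ^ 0 * f x" by simp
    ultimately show ?case using "0.prems"(1) by blast
  next
    case (Suc d)
    show ?case
    proof (cases "\<exists>y. f (y(i := 0)) \<noteq> 0")
      case True
      moreover have "\<forall>x. f x = x i ^ 0 * f x" by simp
      ultimately show ?thesis using Suc.prems(1) by blast
    next
      case False
      obtain g where g: "g \<in> poly_funs I" "\<And>x. f x = f (x(i := 0)) + x i * g x"
        using poly_funs_split_coord[OF Suc.prems(1) i] by blast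
      have fg: "f x = x i * g x" for x using g(2)[of x] False by simp
      have "degree_in_le i d g"
        using degree_in_le_cancel_coord[OF g(1)] Suc.prems(3) by (simp add: fg[abs_def])
      moreover have "g z \<noteq> 0" using fg[of z] Suc.prems(2) by auto
      ultimately obtain e h where h: "h \<in> poly_funs I" "\<And>x. g x = x i ^ e * h x"
        "\<exists>y. h (y(i := 0)) \<noteq> 0"
        using Suc.IH[OF g(1)] by blast
      have "f x = x i ^ Suc e * h x" for x using fg h(2) by simp
      then show ?thesis using h(1,3) by blast
    qed
  qed
  then show ?thesis using that poly_funs_degree_in_le[OF f(1)] by blast
qed

section \<open>Zariski density and generic points\<close>

definition zariski_dense :: "'i set \<Rightarrow> ('i \<Rightarrow> real) set \<Rightarrow> bool" where
  "zariski_dense I S \<longleftrightarrow> (\<forall>f\<in>poly_funs I. (\<forall>x\<in>S. f x = 0) \<longrightarrow> (\<forall>x. f x = 0))"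

lemma zariski_denseD:
  "zariski_dense I S \<Longrightarrow> f \<in> poly_funs I \<Longrightarrow> (\<And>x. x \<in> S \<Longrightarrow> f x = 0) \<Longrightarrow> f x = 0"
  unfolding zariski_dense_def by blast

lemma zariski_dense_mono: "zariski_dense I S \<Longrightarrow> S \<subseteq> T \<Longrightarrow> zariski_dense I T"
  unfolding zariski_dense_def by blast

definition generically :: "'i set \<Rightarrow> (('i \<Rightarrow> real) \<Rightarrow> bool) \<Rightarrow> bool" where
  "generically I P \<longleftrightarrow> (\<exists>h\<in>poly_funs I. (\<exists>x. h x \<noteq> 0) \<and> (\<forall>x. h x \<noteq> 0 \<longrightarrow> P x))"

lemma genericallyI:
  "h \<in> poly_funs I \<Longrightarrow> h z \<noteq> 0 \<Longrightarrow> (\<And>x. h x \<noteq> 0 \<Longrightarrow> P x) \<Longrightarrow> generically I P"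
  unfolding generically_def by blast

lemma generically_mono: "generically I P \<Longrightarrow> (\<And>x. P x \<Longrightarrow> Q x) \<Longrightarrow> generically I Q"
  unfolding generically_def by meson

lemma generically_conj:
  assumes "generically I P" "generically I Q"
  shows "generically I (\<lambda>x. P x \<and> Q x)"
proof -
  obtain f g x y where f: "f \<in> poly_funs I" "f x \<noteq> 0" "\<And>x. f x \<noteq> 0 \<Longrightarrow> P x"
    and g: "g \<in> poly_funs I" "g y \<noteq> 0" "\<And>x. g x \<noteq> 0 \<Longrightarrow> Q x"
    using assms unfolding generically_def by blast
  obtain z where "f z \<noteq> 0" "g z \<noteq> 0"
    using poly_funs_common_nonzero[OF f(1,2) g(1,2)] by blast
  then show ?thesis
    using f g by (intro genericallyI[of "\<lambda>x. f x * g x" _ z] poly_funs.mult) auto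
qed

lemma generically_ball:
  assumes "finite A" "\<And>a. a \<in> A \<Longrightarrow> generically I (P a)"
  shows "generically I (\<lambda>x. \<forall>a\<in>A. P a x)"
  using assms
proof (induction A)
  case empty
  show ?case by (rule genericallyI[of "\<lambda>_. 1"]) (auto intro: poly_funs.const)
next
  case (insert a A)
  then have "generically I (\<lambda>x. P a x \<and> (\<forall>a\<in>A. P a x))" by (intro generically_conj) auto
  then show ?case by simp
qed

lemma generically_Inl:
  assumes "generically (I <+> J) P"
  obtains y where "generically I (\<lambda>x. P (case_sum x y))"
proof -
  obtain h z where h: "h \<in> poly_funs (I <+> J)" "h z \<noteq> 0" "\<And>x. h x \<noteq> 0 \<Longrightarrow> P x"
    using assms unfolding generically_def by blast
  let ?y = "z \<circ> Inr"
  have z: "case_sum (z \<circ> Inl) ?y = z" by (rule ext) (simp split: sum.split)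
  have "generically I (\<lambda>x. P (case_sum x ?y))"
  proof (rule genericallyI)
    show "(\<lambda>x. h (\<lambda>i. case_sum x ?y i)) \<in> poly_funs I"
      by (rule poly_funs_compose[OF h(1)]) (auto intro: poly_funs.intros)
    show "h (\<lambda>i. case_sum (z \<circ> Inl) ?y i) \<noteq> 0" using h(2) by (simp add: z)
    show "P (case_sum x ?y)" if "h (\<lambda>i. case_sum x ?y i) \<noteq> 0" for x using that h(3) by simp
  qed
  then show ?thesis by (rule that)
qed

definition alg_independent :: "'c set \<Rightarrow> ('c \<Rightarrow> ('i \<Rightarrow> real) \<Rightarrow> real) \<Rightarrow> bool" where
  "alg_independent C F \<longleftrightarrow> zariski_dense C (range (\<lambda>x c. F c x))"

lemma alg_independentI:
  "(\<And>q y. q \<in> poly_funs C \<Longrightarrow> (\<And>x. q (\<lambda>c. F c x) = 0) \<Longrightarrow> q y = 0) \<Longrightarrow> alg_independent C F"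
  unfolding alg_independent_def zariski_dense_def by blast

lemma alg_independentD:
  "alg_independent C F \<Longrightarrow> q \<in> poly_funs C \<Longrightarrow> (\<And>x. q (\<lambda>c. F c x) = 0) \<Longrightarrow> q y = 0"
  unfolding alg_independent_def using zariski_denseD by blast

lemma alg_independent_image:
  assumes indep: "alg_independent C (\<lambda>c. F (f c))"
  shows "alg_independent (f ` C) F"
proof (rule alg_independentI)
  fix q y assume q: "q \<in> poly_funs (f ` C)" "\<And>x. q (\<lambda>b. F b x) = 0"
  let ?q = "\<lambda>y. q (\<lambda>b. y (inv_into C f b))"
  have "?q \<in> poly_funs C"
    by (rule poly_funs_compose[OF q(1)]) (auto intro!: poly_funs.coord inv_into_into)
  moreover have "?q (\<lambda>c. F (f c) x) = 0" for x
    using poly_funs_cong[OF q(1), of "\<lambda>b. F (f (inv_into C f b)) x" "\<lambda>b. F b x"] q(2)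
    by (simp add: f_inv_into_f)
  ultimately have "?q (\<lambda>c. y (f c)) = 0" by (rule alg_independentD[OF indep])
  then show "q y = 0"
    using poly_funs_cong[OF q(1), of "\<lambda>b. y (f (inv_into C f b))" y] by (simp add: f_inv_into_f)
qed

section \<open>Linear systems\<close>

lemma homogeneous_system_nontrivial:
  fixes M :: "'a \<Rightarrow> 'b \<Rightarrow> real"
  assumes "finite B" "finite A" "card B < card A"
  shows "\<exists>u. (\<exists>a\<in>A. u a \<noteq> 0) \<and> (\<forall>b\<in>B. (\<Sum>a\<in>A. u a * M a b) = 0)"
  using assms
proof (induction B arbitrary: A M)
  case empty
  then have "A \<noteq> {}" by auto
  then show ?case by (intro exI[of _ "\<lambda>_. 1"]) auto
next
  case (insert b B)
  show ?case
  proof (cases "\<forall>a\<in>A. M a b = 0")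
    case True
    obtain u where "\<exists>a\<in>A. u a \<noteq> 0" "\<forall>b\<in>B. (\<Sum>a\<in>A. u a * M a b) = 0"
      using insert.IH[of A M] insert.prems insert.hyps by auto
    then show ?thesis using True by (intro exI[of _ u]) auto
  next
    case False
    then obtain p where p: "p \<in> A" "M p b \<noteq> 0" by auto
    define A' where "A' = A - {p}"
    define M' where "M' a b' = M a b' - M a b / M p b * M p b'" for a b'
    have A': "finite A'" "p \<notin> A'" "A = insert p A'" using insert.prems p by (auto simp: A'_def)
    then have "card B < card A'" using insert.prems insert.hyps by simp
    then obtain u' where u': "\<exists>a\<in>A'. u' a \<noteq> 0" "\<forall>b\<in>B. (\<Sum>a\<in>A'. u' a * M' a b) = 0"
      using insert.IH[of A' M'] A' by auto
    define u where "u = u'(p := - (\<Sum>a\<in>A'. u' a * (M a b / M p b)))"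
    have "(\<Sum>a\<in>A'. u a * M a b') = (\<Sum>a\<in>A'. u' a * M a b')" for b'
      using A' by (intro sum.cong) (auto simp: u_def)
    then have elim: "(\<Sum>a\<in>A. u a * M a b') = (\<Sum>a\<in>A'. u' a * M' a b')" for b'
      using A'
      by (simp add: u_def M'_def algebra_simps sum_subtractf sum_distrib_left sum_distrib_right)
    have "\<exists>a\<in>A. u a \<noteq> 0" using u'(1) A' by (auto simp: u_def)
    moreover have "M' a b = 0" for a using p by (simp add: M'_def)
    ultimately show ?thesis using u'(2) by (intro exI[of _ u]) (auto simp: elim)
  qed
qed

lemma injective_system_solvable:
  fixes M :: "'a \<Rightarrow> 'a \<Rightarrow> real"
  assumes fin: "finite A"
    and inj: "\<And>u. (\<And>b. b \<in> A \<Longrightarrow> (\<Sum>a\<in>A. u a * M a b) = 0) \<Longrightarrow> \<forall>a\<in>A. u a = 0"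
  shows "\<exists>u. \<forall>b\<in>A. (\<Sum>a\<in>A. u a * M a b) = v b"
proof -
  \<comment> \<open>The extra unknown \<open>None\<close> carries the right-hand side.\<close>
  let ?A = "insert None (Some ` A)"
  have "card A < card ?A" using fin by (simp add: card_image)
  from homogeneous_system_nontrivial[OF fin _ this, of "case_option v M"] fin
  obtain u where u: "\<exists>a\<in>?A. u a \<noteq> 0" "\<forall>b\<in>A. (\<Sum>a\<in>?A. u a * case_option v M a b) = 0" by auto
  have equation: "u None * v b + (\<Sum>a\<in>A. u (Some a) * M a b) = 0" if "b \<in> A" for b
    using u(2) that fin by (simp add: sum.reindex image_iff)
  have nonzero: "u None \<noteq> 0"
  proof
    assume "u None = 0"
    then have "\<forall>a\<in>A. u (Some a) = 0" using equation by (intro inj) auto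
    then show False using u(1) \<open>u None = 0\<close> by auto
  qed
  have "(\<Sum>a\<in>A. - u (Some a) / u None * M a b) = v b" if "b \<in> A" for b
  proof -
    have "(\<Sum>a\<in>A. - u (Some a) / u None * M a b) = - (\<Sum>a\<in>A. u (Some a) * M a b) / u None"
      by (simp add: sum_divide_distrib sum_negf)
    also have "(\<Sum>a\<in>A. u (Some a) * M a b) = - (u None * v b)" using equation[OF that] by linarith
    finally show ?thesis using nonzero by simp
  qed
  then show ?thesis by (intro exI[of _ "\<lambda>a. - u (Some a) / u None"]) auto
qed

lemma linear_injective_imp_surjective:
  fixes T :: "('a \<Rightarrow> real) \<Rightarrow> 'a \<Rightarrow> real"
  assumes fin: "finite A"
    and add: "\<And>u v b. b \<in> A \<Longrightarrow> T (\<lambda>a. u a + v a) b = T u b + T v b"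
    and scale: "\<And>r u b. b \<in> A \<Longrightarrow> T (\<lambda>a. r * u a) b = r * T u b"
    and inj: "\<And>u. (\<And>b. b \<in> A \<Longrightarrow> T u b = 0) \<Longrightarrow> \<forall>a\<in>A. u a = 0"
  shows "\<exists>u. \<forall>b\<in>A. T u b = v b"
proof -
  define e :: "'a \<Rightarrow> 'a \<Rightarrow> real" where "e a = indicator {a}" for a
  have zero: "T (\<lambda>_. 0) b = 0" if "b \<in> A" for b using scale[OF that, of 0 "\<lambda>_. 0"] by simp
  have expand: "T (\<lambda>b. \<Sum>a\<in>A. u a * e a b) c = (\<Sum>a\<in>A. u a * T (e a) c)" if "c \<in> A" for u c
    using fin
    by (induction A rule: finite_induct) (simp_all add: add[OF that] scale[OF that] zero[OF that])
  have "\<exists>u. \<forall>b\<in>A. (\<Sum>a\<in>A. u a * T (e a) b) = v b"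
  proof (rule injective_system_solvable[OF fin])
    fix u assume "\<And>b. b \<in> A \<Longrightarrow> (\<Sum>a\<in>A. u a * T (e a) b) = 0"
    then have "\<forall>b\<in>A. (\<Sum>a\<in>A. u a * e a b) = 0" by (intro inj) (simp add: expand)
    moreover have "(\<Sum>a\<in>A. u a * e a b) = u b" if "b \<in> A" for b
      using fin that by (simp add: e_def indicator_def)
    ultimately show "\<forall>b\<in>A. u b = 0" by simp
  qed
  then obtain u where "\<forall>b\<in>A. (\<Sum>a\<in>A. u a * T (e a) b) = v b" by blast
  then show ?thesis by (intro exI[of _ "\<lambda>b. \<Sum>a\<in>A. u a * e a b"]) (simp add: expand)
qed

lemma independent_rows_imp_surjective:
  fixes D :: "'b \<Rightarrow> 'a \<Rightarrow> real"
  assumes fin: "finite B" "finite A"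
    and rows: "\<And>u. (\<And>a. a \<in> A \<Longrightarrow> (\<Sum>b\<in>B. u b * D b a) = 0) \<Longrightarrow> \<forall>b\<in>B. u b = 0"
  shows "\<exists>w. \<forall>b\<in>B. (\<Sum>a\<in>A. w a * D b a) = v b"
proof -
  define r where "r u a = (\<Sum>b\<in>B. u b * D b a)" for u a
  have r_add: "r (\<lambda>b. u b + u' b) a = r u a + r u' a" for u u' a
    by (simp add: r_def sum.distrib distrib_right)
  have r_scale: "r (\<lambda>b. c * u b) a = c * r u a" for c u a
    by (simp add: r_def sum_distrib_left mult.assoc)
  have "\<exists>u. \<forall>b\<in>B. (\<Sum>a\<in>A. r u a * D b a) = v b"
  proof (rule linear_injective_imp_surjective[OF fin(1)])
    fix u assume zero: "\<And>b. b \<in> B \<Longrightarrow> (\<Sum>a\<in>A. r u a * D b a) = 0"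
    have "(\<Sum>a\<in>A. (r u a)\<^sup>2) = (\<Sum>b\<in>B. u b * (\<Sum>a\<in>A. r u a * D b a))"
      unfolding sum_distrib_left
      by (subst sum.swap) (simp add: r_def power2_eq_square sum_distrib_left mult_ac)
    then have "(\<Sum>a\<in>A. (r u a)\<^sup>2) = 0" using zero by simp
    then have "\<And>a. a \<in> A \<Longrightarrow> r u a = 0" using fin(2) by (simp add: sum_nonneg_eq_0_iff)
    then show "\<forall>b\<in>B. u b = 0" unfolding r_def by (rule rows)
  qed (simp_all add: r_add r_scale sum.distrib sum_distrib_left distrib_right mult.assoc)
  then show ?thesis by blast
qed

lemma injective_imp_independent_rows:
  fixes D :: "'b \<Rightarrow> 'a \<Rightarrow> real"
  assumes fin: "finite B" "finite A" and card: "card B \<le> card A"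
    and inj: "\<And>w. (\<And>b. b \<in> B \<Longrightarrow> (\<Sum>a\<in>A. w a * D b a) = 0) \<Longrightarrow> \<forall>a\<in>A. w a = 0"
    and zero: "\<And>a. a \<in> A \<Longrightarrow> (\<Sum>b\<in>B. u b * D b a) = 0"
  shows "\<forall>b\<in>B. u b = 0"
proof (rule ccontr)
  assume "\<not> ?thesis"
  then obtain c where c: "c \<in> B" "u c \<noteq> 0" by auto
  then have "card (B - {c}) < card A" using card fin card_Diff1_less[of B c] by linarith
  then obtain w where w: "\<exists>a\<in>A. w a \<noteq> 0" "\<And>b. b \<in> B - {c} \<Longrightarrow> (\<Sum>a\<in>A. w a * D b a) = 0"
    using homogeneous_system_nontrivial[of "B - {c}" A "\<lambda>a b. D b a"] fin by blast
  \<comment> \<open>The row \<open>c\<close> is a combination of the others, so \<open>w\<close> solves its equation too.\<close>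
  have "u c * (\<Sum>a\<in>A. w a * D c a) = (\<Sum>b\<in>B. u b * (\<Sum>a\<in>A. w a * D b a))"
    using c fin w(2) by (subst sum.remove[of B c]) auto
  also have "\<dots> = (\<Sum>a\<in>A. w a * (\<Sum>b\<in>B. u b * D b a))"
    unfolding sum_distrib_left by (subst sum.swap) (simp add: mult_ac)
  also have "\<dots> = 0" using zero by simp
  finally have "(\<Sum>a\<in>A. w a * D c a) = 0" using c by simp
  then have "\<forall>a\<in>A. w a = 0" using w(2) by (intro inj) blast
  then show False using w(1) by blast
qed

section \<open>More polynomials than variables are algebraically dependent\<close>

definition grid_lagrange :: "'b set \<Rightarrow> nat \<Rightarrow> ('b \<Rightarrow> nat) \<Rightarrow> ('b \<Rightarrow> real) \<Rightarrow> real" where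
  "grid_lagrange B N a y = (\<Prod>b\<in>B. \<Prod>k\<in>{..N} - {a b}. y b - real k)"

lemma grid_lagrange_poly_funs: "grid_lagrange B N a \<in> poly_funs B"
  unfolding grid_lagrange_def[abs_def]
  by (intro poly_funs_prod poly_funs_diff poly_funs.coord poly_funs.const)

lemma grid_lagrange_self:
  assumes "finite B"
  shows "grid_lagrange B N a (\<lambda>b. real (a b)) \<noteq> 0"
  unfolding grid_lagrange_def using assms by auto

lemma grid_lagrange_other:
  assumes fin: "finite B" and a: "a \<in> B \<rightarrow>\<^sub>E {..N}" "a' \<in> B \<rightarrow>\<^sub>E {..N}" "a \<noteq> a'"
  shows "grid_lagrange B N a (\<lambda>b. real (a' b)) = 0"
proof -
  obtain b where b: "b \<in> B" "a b \<noteq> a' b" using a PiE_ext by metis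
  then have "(\<Prod>k\<in>{..N} - {a b}. real (a' b) - real k) = 0"
    using a(2) by (intro prod_zero bexI[of _ "a' b"]) auto
  then show ?thesis unfolding grid_lagrange_def using fin b(1) by (intro prod_zero) auto
qed

lemma degree_in_le_grid_lagrange:
  assumes a: "a \<in> B \<rightarrow>\<^sub>E {..N}" and F: "\<And>b. b \<in> B \<Longrightarrow> degree_in_le i d (F b)"
  shows "degree_in_le i (card B * (N * d)) (\<lambda>x. grid_lagrange B N a (\<lambda>b. F b x))"
  unfolding grid_lagrange_def
proof (rule degree_in_le_prod)
  fix b assume b: "b \<in> B"
  have "degree_in_le i d (\<lambda>x. F b x - real k)" for k
    using degree_in_le_add[OF F[OF b] degree_in_le_const[of i d "- real k"]] by simp
  then have "degree_in_le i (card ({..N} - {a b}) * d) (\<lambda>x. \<Prod>k\<in>{..N} - {a b}. F b x - real k)"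
    by (rule degree_in_le_prod)
  moreover have "a b \<in> {..N}" using a b by (rule PiE_mem)
  ultimately show "degree_in_le i (N * d) (\<lambda>x. \<Prod>k\<in>{..N} - {a b}. F b x - real k)" by simp
qed

definition grid_interpolant :: "'b set \<Rightarrow> nat \<Rightarrow> (('b \<Rightarrow> nat) \<Rightarrow> real) \<Rightarrow> ('b \<Rightarrow> real) \<Rightarrow> real" where
  "grid_interpolant B N u y = (\<Sum>a\<in>B \<rightarrow>\<^sub>E {..N}. u a * grid_lagrange B N a y)"

lemma grid_interpolant_poly_funs: "grid_interpolant B N u \<in> poly_funs B"
  unfolding grid_interpolant_def[abs_def]
  by (intro poly_funs_sum poly_funs.mult poly_funs.const grid_lagrange_poly_funs)

lemma grid_interpolant_nonzero:
  assumes fin: "finite B" and a: "a \<in> B \<rightarrow>\<^sub>E {..N}" "u a \<noteq> 0"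
  shows "grid_interpolant B N u (\<lambda>b. real (a b)) \<noteq> 0"
proof -
  have "grid_interpolant B N u (\<lambda>b. real (a b)) = u a * grid_lagrange B N a (\<lambda>b. real (a b))"
    unfolding grid_interpolant_def using fin a(1) grid_lagrange_other[OF fin]
    by (subst sum.remove[of _ a]) (auto simp: finite_PiE)
  then show ?thesis using a(2) grid_lagrange_self[OF fin] by simp
qed

lemma degree_in_le_grid_interpolant:
  assumes "\<And>b. b \<in> B \<Longrightarrow> degree_in_le i d (F b)"
  shows "degree_in_le i (card B * (N * d)) (\<lambda>x. grid_interpolant B N u (\<lambda>b. F b x))"
  unfolding grid_interpolant_def
proof (rule degree_in_le_sum)
  fix a assume "a \<in> B \<rightarrow>\<^sub>E {..N}"
  then have "degree_in_le i (card B * (N * d)) (\<lambda>x. grid_lagrange B N a (\<lambda>b. F b x))"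
    using assms by (rule degree_in_le_grid_lagrange)
  from degree_in_le_mult[OF degree_in_le_const[of i 0 "u a"] this]
  show "degree_in_le i (card B * (N * d)) (\<lambda>x. u a * grid_lagrange B N a (\<lambda>b. F b x))" by simp
qed

lemma poly_funs_common_degree_in_le:
  assumes "finite B" "\<And>b. b \<in> B \<Longrightarrow> F b \<in> poly_funs I"
  shows "\<exists>d. \<forall>b\<in>B. \<forall>i. degree_in_le i d (F b)"
proof -
  have "\<forall>b\<in>B. \<exists>d. \<forall>i. degree_in_le i d (F b)" using assms(2) poly_funs_degree_in_le by blast
  then obtain d where d: "\<And>b i. b \<in> B \<Longrightarrow> degree_in_le i (d b) (F b)" by metis
  have "degree_in_le i (\<Sum>b\<in>B. d b) (F b)" if "b \<in> B" for b i
    using assms(1) that by (intro degree_in_le_mono[OF d[OF that]] member_le_sum) auto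
  then show ?thesis by blast
qed

lemma exists_power_dominating:
  fixes k l d :: nat
  assumes "l < k"
  shows "\<exists>N. (k * (N * d) + 1) ^ l < (N + 1) ^ k"
proof -
  define N where "N = (k * d + 1) ^ l"
  have "(k * (N * d) + 1) ^ l \<le> ((N + 1) * (k * d + 1)) ^ l"
    by (rule power_mono) (auto simp: algebra_simps)
  also have "\<dots> = (N + 1) ^ l * N" by (simp only: power_mult_distrib N_def)
  also have "\<dots> < (N + 1) ^ Suc l" by simp
  also have "\<dots> \<le> (N + 1) ^ k" using assms by (intro power_increasing) auto
  finally show ?thesis by blast
qed

text \<open>The polynomials of degree at most \<open>N\<close> in each variable in \<open>B\<close> are parametrised by their values
  on the grid \<open>{0..N}\<^sup>B\<close>, and their pullback along \<open>F\<close> vanishes as soon as it does on a grid with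
  \<open>O(N ^ card I)\<close> points, which is fewer than \<open>(N + 1) ^ card B\<close>.\<close>

lemma alg_independent_card_le:
  assumes fin: "finite I" "finite B" and F: "\<And>b. b \<in> B \<Longrightarrow> F b \<in> poly_funs I"
    and indep: "alg_independent B F"
  shows "card B \<le> card I"
proof (rule ccontr)
  assume "\<not> card B \<le> card I"
  have "\<exists>d. \<forall>b\<in>B. \<forall>i. degree_in_le i d (F b)"
    by (rule poly_funs_common_degree_in_le[OF fin(2) F])
  then obtain d where d: "\<forall>b\<in>B. \<forall>i. degree_in_le i d (F b)" by blast
  obtain N where N: "(card B * (N * d) + 1) ^ card I < (N + 1) ^ card B"
    using exists_power_dominating \<open>\<not> card B \<le> card I\<close> by (meson not_le)
  let ?M = "card B * (N * d)" and ?W = "B \<rightarrow>\<^sub>E {..N}"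
  let ?X = "I \<rightarrow>\<^sub>E real ` {..?M}"
  have "finite ?W" "finite ?X" "card ?X < card ?W"
    using fin N by (auto simp: finite_PiE card_PiE card_image)
  then obtain u a where a: "a \<in> ?W" "u a \<noteq> 0"
    and u: "\<And>x. x \<in> ?X \<Longrightarrow> grid_interpolant B N u (\<lambda>b. F b x) = 0"
    unfolding grid_interpolant_def
    using homogeneous_system_nontrivial[of ?X ?W "\<lambda>a x. grid_lagrange B N a (\<lambda>b. F b x)"] by blast
  let ?q = "grid_interpolant B N u"
  have pullback: "(\<lambda>x. ?q (\<lambda>b. F b x)) \<in> poly_funs I"
    by (rule poly_funs_compose[OF grid_interpolant_poly_funs F])
  have "?q (\<lambda>b. F b x) = 0" for x
  proof (rule degree_in_le_zero_on_grid[OF fin(1), where d = ?M and S = "real ` {..?M}" and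
        f = "\<lambda>x. ?q (\<lambda>b. F b x)"])
    fix x assume "\<And>i. i \<in> I \<Longrightarrow> x i \<in> real ` {..?M}"
    then have "?q (\<lambda>b. F b (restrict x I)) = 0" by (intro u) auto
    then show "?q (\<lambda>b. F b x) = 0" using poly_funs_cong[OF pullback, of "restrict x I" x] by simp
  qed (use d in \<open>auto intro: degree_in_le_grid_interpolant simp: card_image\<close>)
  then have "?q (\<lambda>b. real (a b)) = 0"
    by (rule alg_independentD[OF indep grid_interpolant_poly_funs])
  then show False using grid_interpolant_nonzero[where u = u, OF fin(2) a] by simp
qed

section \<open>Krull dimension of real affine space\<close>

lemma zariski_closed_subset: "zariski_closed I Z \<Longrightarrow> Z \<subseteq> I \<rightarrow>\<^sub>E UNIV"
  unfolding zariski_closed_def by auto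

lemma zariski_closed_zero_set:
  "F \<subseteq> poly_funs I \<Longrightarrow> zariski_closed I {x \<in> I \<rightarrow>\<^sub>E UNIV. \<forall>f\<in>F. f x = 0}"
  unfolding zariski_closed_def by blast

lemma zariski_closed_separating:
  assumes "zariski_closed I Z" "x \<in> I \<rightarrow>\<^sub>E UNIV" "x \<notin> Z"
  shows "\<exists>f\<in>poly_funs I. (\<forall>z\<in>Z. f z = 0) \<and> f x \<noteq> 0"
  using assms unfolding zariski_closed_def by blast

lemma zariski_dense_iff_hull:
  assumes S: "S \<subseteq> I \<rightarrow>\<^sub>E UNIV"
  shows "zariski_dense I S \<longleftrightarrow> zariski_closed I hull S = I \<rightarrow>\<^sub>E UNIV"
proof
  assume dense: "zariski_dense I S"
  have least: "I \<rightarrow>\<^sub>E UNIV \<subseteq> Z" if Z: "S \<subseteq> Z" "zariski_closed I Z" for Z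
  proof (rule subsetI, rule ccontr)
    fix x :: "'a \<Rightarrow> real" assume "x \<in> I \<rightarrow>\<^sub>E UNIV" "x \<notin> Z"
    then obtain f where f: "f \<in> poly_funs I" "\<forall>z\<in>Z. f z = 0" "f x \<noteq> 0"
      using zariski_closed_separating[OF Z(2)] by blast
    have "f x = 0" by (rule zariski_denseD[OF dense f(1)]) (use f(2) Z(1) in blast)
    then show False using f(3) by simp
  qed
  have "zariski_closed I (I \<rightarrow>\<^sub>E UNIV)" using zariski_closed_zero_set[of "{}" I] by simp
  then show "zariski_closed I hull S = I \<rightarrow>\<^sub>E UNIV" by (rule hull_unique[OF S _ least])
next
  assume hull: "zariski_closed I hull S = I \<rightarrow>\<^sub>E UNIV"
  show "zariski_dense I S"
    unfolding zariski_dense_def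
  proof (intro ballI impI allI)
    fix f x assume f: "f \<in> poly_funs I" "\<forall>x\<in>S. f x = 0"
    have "zariski_closed I hull S \<subseteq> {x \<in> I \<rightarrow>\<^sub>E UNIV. \<forall>g\<in>{f}. g x = 0}"
      using f S by (intro hull_minimal zariski_closed_zero_set) auto
    moreover have "restrict x I \<in> zariski_closed I hull S" by (simp add: hull)
    ultimately have "f (restrict x I) = 0" by blast
    then show "f x = 0" using poly_funs_cong[OF f(1), of "restrict x I" x] by simp
  qed
qed

lemma zariski_irreducible_prime:
  assumes Z: "zariski_irreducible I Z" "Z \<subseteq> I \<rightarrow>\<^sub>E UNIV"
    and fg: "f \<in> poly_funs I" "g \<in> poly_funs I" "\<And>x. x \<in> Z \<Longrightarrow> f x * g x = 0"
  shows "(\<forall>x\<in>Z. f x = 0) \<or> (\<forall>x\<in>Z. g x = 0)"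
proof -
  let ?V = "\<lambda>f. {x \<in> I \<rightarrow>\<^sub>E UNIV. \<forall>h\<in>{f}. h x = 0}"
  have "zariski_closed I (?V f)" "zariski_closed I (?V g)"
    using fg by (intro zariski_closed_zero_set; simp)+
  moreover have "Z \<subseteq> ?V f \<union> ?V g" using Z(2) fg(3) by fastforce
  ultimately have "Z \<subseteq> ?V f \<or> Z \<subseteq> ?V g" using Z(1) unfolding zariski_irreducible_def by meson
  then show ?thesis by blast
qed

lemma zariski_irreducible_range:
  assumes g: "\<And>i. i \<in> I \<Longrightarrow> g i \<in> poly_funs J"
  shows "zariski_irreducible I (range (\<lambda>x. \<lambda>i\<in>I. g i x))"
  unfolding zariski_irreducible_def
proof (intro conjI allI impI)
  let ?\<gamma> = "\<lambda>x. \<lambda>i\<in>I. g i x"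
  show "range ?\<gamma> \<noteq> {}" by simp
  fix A B
  assume AB: "zariski_closed I A \<and> zariski_closed I B \<and> range ?\<gamma> \<subseteq> A \<union> B"
  show "range ?\<gamma> \<subseteq> A \<or> range ?\<gamma> \<subseteq> B"
  proof (rule ccontr)
    assume "\<not> ?thesis"
    then obtain x y where "?\<gamma> x \<notin> A" "?\<gamma> y \<notin> B" by blast
    have \<gamma>: "?\<gamma> x \<in> I \<rightarrow>\<^sub>E UNIV" for x by simp
    obtain f where f: "f \<in> poly_funs I" "\<forall>z\<in>A. f z = 0" "f (?\<gamma> x) \<noteq> 0"
      using zariski_closed_separating[OF _ \<gamma> \<open>?\<gamma> x \<notin> A\<close>] AB(1) by blast
    obtain h where h: "h \<in> poly_funs I" "\<forall>z\<in>B. h z = 0" "h (?\<gamma> y) \<noteq> 0"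
      using zariski_closed_separating[OF _ \<gamma> \<open>?\<gamma> y \<notin> B\<close>] AB(1) by blast
    have pullback: "(\<lambda>x. q (?\<gamma> x)) \<in> poly_funs J" if "q \<in> poly_funs I" for q
    proof -
      have "(\<lambda>x. q (?\<gamma> x)) = (\<lambda>x. q (\<lambda>i. g i x))" by (intro ext poly_funs_cong[OF that]) simp
      then show ?thesis using poly_funs_compose[OF that g] by simp
    qed
    obtain z where "f (?\<gamma> z) \<noteq> 0" "h (?\<gamma> z) \<noteq> 0"
      using poly_funs_common_nonzero[of "\<lambda>x. f (?\<gamma> x)" J x "\<lambda>x. h (?\<gamma> x)" y] f h pullback by blast
    then have "?\<gamma> z \<notin> A" "?\<gamma> z \<notin> B" using f(2) h(2) by blast+
    then show False using AB(1) by blast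
  qed
qed

definition irreducible_chain :: "'i set \<Rightarrow> nat \<Rightarrow> (nat \<Rightarrow> ('i \<Rightarrow> real) set) \<Rightarrow> bool" where
  "irreducible_chain I k Z \<longleftrightarrow>
     (\<forall>i\<le>k. zariski_closed I (Z i) \<and> zariski_irreducible I (Z i)) \<and> (\<forall>i<k. Z i \<subset> Z (Suc i))"

lemma irreducible_chainD:
  assumes "irreducible_chain I k Z"
  shows "i \<le> k \<Longrightarrow> zariski_closed I (Z i)" "i \<le> k \<Longrightarrow> zariski_irreducible I (Z i)"
    "i \<le> k \<Longrightarrow> Z i \<subseteq> I \<rightarrow>\<^sub>E UNIV" "i < k \<Longrightarrow> Z i \<subset> Z (Suc i)"
proof -
  show "i \<le> k \<Longrightarrow> zariski_closed I (Z i)" "i \<le> k \<Longrightarrow> zariski_irreducible I (Z i)"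
    "i < k \<Longrightarrow> Z i \<subset> Z (Suc i)"
    using assms unfolding irreducible_chain_def by simp_all
  then show "i \<le> k \<Longrightarrow> Z i \<subseteq> I \<rightarrow>\<^sub>E UNIV" by (intro zariski_closed_subset)
qed

lemma zariski_dense_separating_step:
  assumes irr: "zariski_irreducible I Z'" "Z' \<subseteq> I \<rightarrow>\<^sub>E UNIV" and sub: "Z \<subseteq> Z'"
    and f: "\<And>i. i < Suc j \<Longrightarrow> f i \<in> poly_funs I"
    and sep: "\<And>x. x \<in> Z \<Longrightarrow> f j x = 0" "\<exists>x\<in>Z'. f j x \<noteq> 0"
    and dense: "zariski_dense {..<j} ((\<lambda>x i. f i x) ` Z)"
  shows "zariski_dense {..<Suc j} ((\<lambda>x i. f i x) ` Z')"
  unfolding zariski_dense_def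
proof (intro ballI impI allI, rule ccontr)
  fix q y
  assume q: "q \<in> poly_funs {..<Suc j}" "\<forall>y\<in>(\<lambda>x i. f i x) ` Z'. q y = 0" "q y \<noteq> 0"
  have "j \<in> {..<Suc j}" by simp
  then obtain g e z
    where g: "g \<in> poly_funs {..<Suc j}" "\<forall>y. q y = y j ^ e * g y" "g (z(j := 0)) \<noteq> 0"
    by (rule poly_funs_factor_coord[OF q(1,3)])
  have "(\<lambda>x. f j x ^ e) \<in> poly_funs I" by (rule poly_funs_power[OF f]) simp
  moreover have "(\<lambda>x. g (\<lambda>i. f i x)) \<in> poly_funs I"
    by (rule poly_funs_compose[OF g(1)]) (use f in simp)
  moreover have "f j x ^ e * g (\<lambda>i. f i x) = 0" if "x \<in> Z'" for x
    using q(2) that by (simp add: g(2))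
  ultimately have "(\<forall>x\<in>Z'. f j x ^ e = 0) \<or> (\<forall>x\<in>Z'. g (\<lambda>i. f i x) = 0)"
    by (rule zariski_irreducible_prime[OF irr])
  then have "\<forall>x\<in>Z'. g (\<lambda>i. f i x) = 0" using sep(2) by auto
  then have zero: "g ((\<lambda>i. f i x)(j := 0)) = 0" if "x \<in> Z" for x
    using sep(1)[OF that] sub that by (subst fun_upd_idem) auto
  have "(\<lambda>y. g (y(j := 0))) \<in> poly_funs {..<j}"
    using g(1) by (intro poly_funs_fix_coord) (simp add: lessThan_Suc)
  then have "g (z(j := 0)) = 0" by (rule zariski_denseD[OF dense]) (use zero in blast)
  then show False using g(3) by simp
qed

lemma irreducible_chain_separating_dense:
  assumes Z: "irreducible_chain I k Z"
    and f: "\<And>i. i < k \<Longrightarrow> f i \<in> poly_funs I" "\<And>i x. i < k \<Longrightarrow> x \<in> Z i \<Longrightarrow> f i x = 0"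
      "\<And>i. i < k \<Longrightarrow> \<exists>x\<in>Z (Suc i). f i x \<noteq> 0"
  shows "j \<le> k \<Longrightarrow> zariski_dense {..<j} ((\<lambda>x i. f i x) ` Z j)"
proof (induction j)
  case 0
  obtain x where x: "x \<in> Z 0"
    using irreducible_chainD(2)[OF Z le0] unfolding zariski_irreducible_def by blast
  show ?case
    unfolding zariski_dense_def
  proof (intro ballI impI allI)
    fix q y assume q: "q \<in> poly_funs {..<0}" "\<forall>y\<in>(\<lambda>x i. f i x) ` Z 0. q y = 0"
    have "q y = q (\<lambda>i. f i x)" by (rule poly_funs_cong[OF q(1)]) simp
    also have "\<dots> = 0" using q(2) x by blast
    finally show "q y = 0" .
  qed
next
  case (Suc j)
  then have j: "j < k" by simp
  show ?case
  proof (rule zariski_dense_separating_step[OF irreducible_chainD(2,3)[OF Z Suc.prems]])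
    show "Z j \<subseteq> Z (Suc j)" using irreducible_chainD(4)[OF Z j] by blast
    show "zariski_dense {..<j} ((\<lambda>x i. f i x) ` Z j)" by (rule Suc.IH[OF less_imp_le[OF j]])
  qed (use j f in simp_all)
qed

lemma irreducible_chain_length:
  assumes fin: "finite I" and Z: "irreducible_chain I k Z"
  shows "k \<le> card I"
proof -
  define separates where "separates i f \<longleftrightarrow>
    f \<in> poly_funs I \<and> (\<forall>x\<in>Z i. f x = 0) \<and> (\<exists>x\<in>Z (Suc i). f x \<noteq> 0)" for i f
  have "\<exists>f. separates i f" if i: "i < k" for i
  proof -
    obtain x where x: "x \<in> Z (Suc i)" "x \<notin> Z i" using irreducible_chainD(4)[OF Z i] by blast
    moreover have "x \<in> I \<rightarrow>\<^sub>E UNIV" using irreducible_chainD(3)[OF Z Suc_leI[OF i]] x(1) by blast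
    ultimately show ?thesis
      unfolding separates_def
      using zariski_closed_separating[OF irreducible_chainD(1)[OF Z less_imp_le[OF i]]] by blast
  qed
  then obtain f where "\<And>i. i < k \<Longrightarrow> separates i (f i)" by metis
  then have f: "\<And>i. i < k \<Longrightarrow> f i \<in> poly_funs I" "\<And>i x. i < k \<Longrightarrow> x \<in> Z i \<Longrightarrow> f i x = 0"
    "\<And>i. i < k \<Longrightarrow> \<exists>x\<in>Z (Suc i). f i x \<noteq> 0"
    unfolding separates_def by blast+
  have "zariski_dense {..<k} ((\<lambda>x i. f i x) ` Z k)"
    by (rule irreducible_chain_separating_dense[of I k Z f k, OF Z f order_refl])
  then have "alg_independent {..<k} f"
    unfolding alg_independent_def by (rule zariski_dense_mono) auto
  then have "card {..<k} \<le> card I" using fin f(1) by (intro alg_independent_card_le) auto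
  then show ?thesis by simp
qed

definition coordinate_flat :: "'i set \<Rightarrow> 'i set \<Rightarrow> ('i \<Rightarrow> real) set" where
  "coordinate_flat I J = {x \<in> I \<rightarrow>\<^sub>E UNIV. \<forall>i\<in>I - J. x i = 0}"

lemma zariski_closed_coordinate_flat: "zariski_closed I (coordinate_flat I J)"
  unfolding zariski_closed_def coordinate_flat_def
  by (intro exI[of _ "(\<lambda>i x. x i) ` (I - J)"]) (auto intro: poly_funs.coord)

lemma zariski_irreducible_coordinate_flat: "zariski_irreducible I (coordinate_flat I J)"
proof -
  let ?g = "\<lambda>i x. if i \<in> J then x i else 0 :: real"
  have "coordinate_flat I J = range (\<lambda>x. \<lambda>i\<in>I. ?g i x)"
  proof (intro equalityI subsetI)
    fix x assume "x \<in> coordinate_flat I J"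
    then have "x = (\<lambda>i\<in>I. ?g i x)"
      by (auto simp: coordinate_flat_def fun_eq_iff PiE_def extensional_def)
    then show "x \<in> range (\<lambda>x. \<lambda>i\<in>I. ?g i x)" by blast
  qed (auto simp: coordinate_flat_def)
  moreover have "?g i \<in> poly_funs J" for i by (cases "i \<in> J") (auto intro: poly_funs.intros)
  ultimately show ?thesis using zariski_irreducible_range[of I ?g J] by simp
qed

lemma coordinate_flat_strict_mono:
  assumes "J \<subset> J'" "J' \<subseteq> I"
  shows "coordinate_flat I J \<subset> coordinate_flat I J'"
proof
  show "coordinate_flat I J \<subseteq> coordinate_flat I J'" using assms by (auto simp: coordinate_flat_def)
  obtain j where j: "j \<in> J'" "j \<notin> J" using assms by auto
  then have "restrict (indicator {j}) I \<in> coordinate_flat I J' - coordinate_flat I J"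
    using assms by (auto simp: coordinate_flat_def indicator_def)
  then show "coordinate_flat I J \<noteq> coordinate_flat I J'" by blast
qed

lemma irreducible_chain_coordinate_flats:
  assumes "finite I"
  obtains Z where "irreducible_chain I (card I) Z"
proof -
  obtain b where b: "bij_betw b {..<card I} I"
    using ex_bij_betw_nat_finite[OF assms] by (auto simp: atLeast0LessThan)
  have "b ` {..<i} \<subset> b ` {..<Suc i}" "b ` {..<Suc i} \<subseteq> I" if "i < card I" for i
  proof -
    have "b i \<notin> b ` {..<i}" using bij_betw_imp_inj_on[OF b] that by (fastforce simp: inj_on_def)
    then show "b ` {..<i} \<subset> b ` {..<Suc i}" by (auto simp: lessThan_Suc)
    show "b ` {..<Suc i} \<subseteq> I" using bij_betw_imp_surj_on[OF b] that by auto
  qed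
  then have "irreducible_chain I (card I) (\<lambda>i. coordinate_flat I (b ` {..<i}))"
    unfolding irreducible_chain_def
    by (simp add: zariski_closed_coordinate_flat zariski_irreducible_coordinate_flat
        coordinate_flat_strict_mono)
  then show ?thesis by (rule that)
qed

lemma irreducible_chain_snoc:
  assumes "irreducible_chain I k Z" and "Z k \<subset> I \<rightarrow>\<^sub>E UNIV"
  shows "irreducible_chain I (Suc k) (Z(Suc k := I \<rightarrow>\<^sub>E UNIV))"
proof -
  have "I \<rightarrow>\<^sub>E UNIV = coordinate_flat I I" by (simp add: coordinate_flat_def)
  then show ?thesis
    using assms zariski_closed_coordinate_flat[of I I] zariski_irreducible_coordinate_flat[of I I]
    by (auto simp: irreducible_chain_def le_Suc_eq less_Suc_eq)
qed

lemma alg_dim_eq_Sup_irreducible_chain: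
  "alg_dim I S = Sup {enat k | k. \<exists>Z. irreducible_chain I k Z \<and> Z k \<subseteq> zariski_closed I hull S}"
proof -
  have "(\<forall>i\<le>k. Z i \<subseteq> zariski_closed I hull S) \<longleftrightarrow> Z k \<subseteq> zariski_closed I hull S"
    if "irreducible_chain I k Z" for k Z
  proof -
    have "Z i \<subseteq> Z k" if "i \<le> k" for i
      using that \<open>irreducible_chain I k Z\<close>
      by (induction rule: inc_induct) (auto simp: irreducible_chain_def)
    then show ?thesis by blast
  qed
  then have "(\<forall>i\<le>k. zariski_closed I (Z i) \<and> zariski_irreducible I (Z i) \<and>
        Z i \<subseteq> zariski_closed I hull S) \<and>
      (\<forall>i<k. Z i \<subset> Z (Suc i)) \<longleftrightarrow> irreducible_chain I k Z \<and> Z k \<subseteq> zariski_closed I hull S" for k Z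
    unfolding irreducible_chain_def by blast
  then show ?thesis unfolding alg_dim_def by simp
qed

lemma alg_dim_le:
  assumes "\<And>k Z. irreducible_chain I k Z \<Longrightarrow> Z k \<subseteq> zariski_closed I hull S \<Longrightarrow> k \<le> d"
  shows "alg_dim I S \<le> enat d"
  unfolding alg_dim_eq_Sup_irreducible_chain using assms by (intro Sup_least) auto

lemma zariski_dense_alg_dim:
  assumes fin: "finite I" and S: "S \<subseteq> I \<rightarrow>\<^sub>E UNIV" and dense: "zariski_dense I S"
  shows "alg_dim I S = enat (card I)"
proof (rule antisym)
  show "alg_dim I S \<le> enat (card I)" using irreducible_chain_length[OF fin] by (rule alg_dim_le)
  obtain Z where Z: "irreducible_chain I (card I) Z"
    by (rule irreducible_chain_coordinate_flats[OF fin])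
  then have "Z (card I) \<subseteq> zariski_closed I hull S"
    using dense irreducible_chainD(3)[OF Z order_refl] by (simp add: zariski_dense_iff_hull[OF S])
  then show "enat (card I) \<le> alg_dim I S"
    unfolding alg_dim_eq_Sup_irreducible_chain using Z by (intro Sup_upper) blast
qed

lemma not_zariski_dense_alg_dim_less:
  assumes fin: "finite I" and S: "S \<noteq> {}" "S \<subseteq> I \<rightarrow>\<^sub>E UNIV" and not_dense: "\<not> zariski_dense I S"
  shows "alg_dim I S < enat (card I)"
proof -
  have "zariski_closed I hull S \<subseteq> I \<rightarrow>\<^sub>E UNIV"
    using S(2) zariski_closed_zero_set[of "{}" I] by (intro hull_minimal) auto
  then have hull: "zariski_closed I hull S \<subset> I \<rightarrow>\<^sub>E UNIV"
    using not_dense by (simp add: zariski_dense_iff_hull[OF S(2)] psubset_eq)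
  have less: "k < card I" if "irreducible_chain I k Z" "Z k \<subseteq> zariski_closed I hull S" for k Z
  proof -
    have "irreducible_chain I (Suc k) (Z(Suc k := I \<rightarrow>\<^sub>E UNIV))"
      using that hull by (intro irreducible_chain_snoc) auto
    then show ?thesis using irreducible_chain_length[OF fin] by fastforce
  qed
  have "card I \<noteq> 0"
  proof
    assume "card I = 0"
    then have "f x = f y" if "f \<in> poly_funs I" for f x y using fin poly_funs_cong[OF that] by simp
    then have "zariski_dense I S" unfolding zariski_dense_def using S(1) by (metis all_not_in_conv)
    then show False using not_dense by simp
  qed
  have "alg_dim I S \<le> enat (card I - 1)" using less by (intro alg_dim_le) fastforce
  also have "\<dots> < enat (card I)" using \<open>card I \<noteq> 0\<close> by simp
  finally show ?thesis .
qed

lemma alg_dim_eq_card_iff: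
  assumes "finite I" "S \<noteq> {}" "S \<subseteq> I \<rightarrow>\<^sub>E UNIV"
  shows "alg_dim I S = enat (card I) \<longleftrightarrow> zariski_dense I S"
  using zariski_dense_alg_dim[OF assms(1,3)] not_zariski_dense_alg_dim_less[OF assms]
  by (cases "zariski_dense I S") auto

section \<open>Directional derivatives\<close>

definition dir_deriv :: "(('i \<Rightarrow> real) \<Rightarrow> real) \<Rightarrow> ('i \<Rightarrow> real) \<Rightarrow> ('i \<Rightarrow> real) \<Rightarrow> real" where
  "dir_deriv f x w = deriv (\<lambda>s. f (\<lambda>i. x i + s * w i)) 0"

lemma dir_deriv_eqI:
  "((\<lambda>s. f (\<lambda>i. x i + s * w i)) has_real_derivative D) (at 0) \<Longrightarrow> dir_deriv f x w = D"
  unfolding dir_deriv_def by (rule DERIV_imp_deriv)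

lemma poly_funs_has_dir_deriv:
  assumes "f \<in> poly_funs I"
  shows "((\<lambda>s. f (\<lambda>i. x i + s * w i)) has_real_derivative dir_deriv f x w) (at 0)"
proof -
  obtain p where "\<And>s. f (\<lambda>i. x i + s * w i) = poly p s" using poly_funs_line[OF assms] by metis
  then have "((\<lambda>s. f (\<lambda>i. x i + s * w i)) has_real_derivative poly (pderiv p) 0) (at 0)" by simp
  then show ?thesis by (simp add: dir_deriv_eqI)
qed

lemma dir_deriv_const: "dir_deriv (\<lambda>_. c) x w = 0"
  by (rule dir_deriv_eqI) simp

lemma dir_deriv_coord: "dir_deriv (\<lambda>x. x i) x w = w i"
  by (rule dir_deriv_eqI) (auto intro!: derivative_eq_intros)

lemma dir_deriv_add:
  assumes "f \<in> poly_funs I" "g \<in> poly_funs J"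
  shows "dir_deriv (\<lambda>x. f x + g x) x w = dir_deriv f x w + dir_deriv g x w"
  by (intro dir_deriv_eqI DERIV_add poly_funs_has_dir_deriv[OF assms(1)]
      poly_funs_has_dir_deriv[OF assms(2)])

lemma dir_deriv_mult:
  assumes "f \<in> poly_funs I" "g \<in> poly_funs J"
  shows "dir_deriv (\<lambda>x. f x * g x) x w = dir_deriv f x w * g x + dir_deriv g x w * f x"
  using DERIV_mult[OF poly_funs_has_dir_deriv[OF assms(1), of x w]
      poly_funs_has_dir_deriv[OF assms(2), of x w]]
  by (intro dir_deriv_eqI) simp

lemma dir_deriv_linear_combination:
  assumes "\<And>c. c \<in> C \<Longrightarrow> F c \<in> poly_funs I"
  shows "dir_deriv (\<lambda>x. \<Sum>c\<in>C. u c * F c x) x w = (\<Sum>c\<in>C. u c * dir_deriv (F c) x w)"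
  by (rule dir_deriv_eqI) (intro DERIV_sum DERIV_cmult poly_funs_has_dir_deriv[OF assms])

lemma dir_deriv_compose:
  assumes q: "q \<in> poly_funs B" and F: "\<And>b. b \<in> B \<Longrightarrow> F b \<in> poly_funs I"
  shows "dir_deriv (\<lambda>x. q (\<lambda>b. F b x)) x w = dir_deriv q (\<lambda>b. F b x) (\<lambda>b. dir_deriv (F b) x w)"
proof -
  have comp: "(\<lambda>x. f (\<lambda>b. F b x)) \<in> poly_funs I" if "f \<in> poly_funs B" for f
    by (rule poly_funs_compose[OF that F])
  show ?thesis
    using q
  proof induction
    case (add f g)
    then show ?case
      using dir_deriv_add[OF comp comp, of f g x w] dir_deriv_add[of f B g B] by simp
  next
    case (mult f g)
    then show ?case
      using dir_deriv_mult[OF comp comp, of f g x w] dir_deriv_mult[of f B g B] by simp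
  qed (simp_all add: dir_deriv_const dir_deriv_coord)
qed

lemma dir_deriv_eq_sum_partial:
  assumes "f \<in> poly_funs I" "finite I"
  shows "dir_deriv f x w = (\<Sum>i\<in>I. w i * dir_deriv f x (indicator {i}))"
  using assms(1)
proof induction
  case (coord j)
  have "(\<Sum>i\<in>I. w i * indicator {i} j) = w j"
    using coord assms(2) by (simp add: indicator_def)
  then show ?case by (simp add: dir_deriv_coord)
next
  case (add f g)
  then show ?case by (simp add: dir_deriv_add[OF add.hyps] sum.distrib distrib_left)
next
  case (mult f g)
  then show ?case
    by (simp add: dir_deriv_mult[OF mult.hyps] sum.distrib distrib_left sum_distrib_right
        mult.assoc)
qed (simp add: dir_deriv_const)

lemma poly_funs_dir_deriv:
  assumes "f \<in> poly_funs I"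
  shows "(\<lambda>x. dir_deriv f x w) \<in> poly_funs I"
  using assms
proof induction
  case (add f g)
  then show ?case by (simp add: dir_deriv_add[OF add.hyps] poly_funs.add)
next
  case (mult f g)
  then show ?case by (simp add: dir_deriv_mult[OF mult.hyps] poly_funs.add poly_funs.mult)
qed (simp_all add: dir_deriv_const dir_deriv_coord poly_funs.const)

lemma dir_deriv_indicator:
  assumes "\<And>s. f (x(i := s)) = poly p s"
  shows "dir_deriv f (x(i := s)) (indicator {i}) = poly (pderiv p) s"
proof (rule dir_deriv_eqI)
  have "(\<lambda>j. (x(i := s)) j + r * indicator {i} j) = x(i := s + r)" for r
    by (auto simp: indicator_def)
  then have "(\<lambda>r. f (\<lambda>j. (x(i := s)) j + r * indicator {i} j)) = (\<lambda>r. poly p (s + r))"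
    by (simp add: assms)
  moreover have "((\<lambda>r. poly p (s + r)) has_real_derivative poly (pderiv p) s) (at 0)"
    by (auto intro!: derivative_eq_intros)
  ultimately show "((\<lambda>r. f (\<lambda>j. (x(i := s)) j + r * indicator {i} j)) has_real_derivative
      poly (pderiv p) s) (at 0)" by simp
qed

lemma degree_in_le_dir_deriv:
  assumes "degree_in_le i d f"
  shows "degree_in_le i (d - 1) (\<lambda>x. dir_deriv f x (indicator {i}))"
  unfolding degree_in_le_def
proof
  fix x
  obtain p where p: "degree p \<le> d" "\<And>s. f (x(i := s)) = poly p s"
    using degree_in_leE[OF assms] by metis
  then show "\<exists>p. degree p \<le> d - 1 \<and> (\<forall>s. dir_deriv f (x(i := s)) (indicator {i}) = poly p s)"
    by (intro exI[of _ "pderiv p"]) (simp add: degree_pderiv dir_deriv_indicator)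
qed

lemma dir_deriv_zero_imp_degree_in_le_0:
  assumes f: "f \<in> poly_funs I" and zero: "\<And>x. dir_deriv f x (indicator {i}) = 0"
  shows "degree_in_le i 0 f"
  unfolding degree_in_le_def
proof
  fix x
  obtain p where p: "\<And>s. f (x(i := s)) = poly p s"
    using poly_funs_degree_in_le[OF f] degree_in_leE by metis
  have "poly (pderiv p) s = 0" for s using zero by (simp add: dir_deriv_indicator[OF p, symmetric])
  then have "degree p = 0" using poly_all_0_iff_0 pderiv_eq_0_iff by blast
  then show "\<exists>p. degree p \<le> 0 \<and> (\<forall>s. f (x(i := s)) = poly p s)" using p by auto
qed

section \<open>The Jacobian criterion\<close>

definition submersion_at :: "'c set \<Rightarrow> ('c \<Rightarrow> ('i \<Rightarrow> real) \<Rightarrow> real) \<Rightarrow> ('i \<Rightarrow> real) \<Rightarrow> bool" where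
  "submersion_at C F x \<longleftrightarrow>
     (\<forall>u. (\<forall>w. (\<Sum>c\<in>C. u c * dir_deriv (F c) x w) = 0) \<longrightarrow> (\<forall>c\<in>C. u c = 0))"

lemma submersion_at_surjective:
  assumes fin: "finite C" "finite I" and F: "\<And>c. c \<in> C \<Longrightarrow> F c \<in> poly_funs I"
    and sub: "submersion_at C F x"
  shows "\<exists>w. \<forall>c\<in>C. dir_deriv (F c) x w = v c"
proof -
  have partial: "dir_deriv (F c) x w = (\<Sum>i\<in>I. w i * dir_deriv (F c) x (indicator {i}))"
    if "c \<in> C" for c w
    by (rule dir_deriv_eq_sum_partial[OF F[OF that] fin(2)])
  have "\<exists>w. \<forall>c\<in>C. (\<Sum>i\<in>I. w i * dir_deriv (F c) x (indicator {i})) = v c"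
  proof (rule independent_rows_imp_surjective[OF fin])
    fix u assume u: "\<And>i. i \<in> I \<Longrightarrow> (\<Sum>c\<in>C. u c * dir_deriv (F c) x (indicator {i})) = 0"
    have "(\<Sum>c\<in>C. u c * dir_deriv (F c) x w) = 0" for w
    proof -
      have "(\<Sum>c\<in>C. u c * dir_deriv (F c) x w) =
          (\<Sum>c\<in>C. u c * (\<Sum>i\<in>I. w i * dir_deriv (F c) x (indicator {i})))"
        by (intro sum.cong refl arg_cong[OF partial])
      also have "\<dots> = (\<Sum>i\<in>I. w i * (\<Sum>c\<in>C. u c * dir_deriv (F c) x (indicator {i})))"
        unfolding sum_distrib_left by (subst sum.swap) (simp add: mult_ac)
      finally show ?thesis using u by simp
    qed
    then show "\<forall>c\<in>C. u c = 0" using sub unfolding submersion_at_def by blast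
  qed
  then obtain w where "\<forall>c\<in>C. (\<Sum>i\<in>I. w i * dir_deriv (F c) x (indicator {i})) = v c" by blast
  then have "\<forall>c\<in>C. dir_deriv (F c) x w = v c" using partial[of _ w] by simp
  then show ?thesis by blast
qed

text \<open>Adjoining \<open>s\<close> as a coordinate and splitting off its highest power isolates the lowest-order
  homogeneous part of \<open>f\<close> at \<open>x\<close>.\<close>

lemma poly_funs_leading_form:
  assumes f: "f \<in> poly_funs I" "f z \<noteq> 0"
  obtains g e y where "g \<in> poly_funs (insert None (Some ` I))"
    "\<forall>s y. f (\<lambda>i. x i + s * y i) = s ^ e * g (case_option s y)" "g (case_option 0 y) \<noteq> 0"
proof -
  let ?I = "insert None (Some ` I)" and ?f = "\<lambda>y. f (\<lambda>i. x i + y None * y (Some i))"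
    and ?z = "case_option 1 (\<lambda>i. z i - x i)"
  have "?f \<in> poly_funs ?I"
    by (rule poly_funs_compose[OF f(1)])
       (auto intro!: poly_funs.add poly_funs.mult poly_funs.const poly_funs.coord)
  moreover have "?f ?z \<noteq> 0" "None \<in> ?I" using f(2) by simp_all
  ultimately obtain g e y
    where g: "g \<in> poly_funs ?I" "\<forall>y. ?f y = y None ^ e * g y" "g (y(None := 0)) \<noteq> 0"
    by (rule poly_funs_factor_coord[of ?f ?I ?z None])
  have "y(None := 0) = case_option 0 (y \<circ> Some)" by (auto split: option.split)
  then have "g (case_option 0 (y \<circ> Some)) \<noteq> 0" using g(3) by simp
  moreover have "f (\<lambda>i. x i + s * y i) = s ^ e * g (case_option s y)" for s y
    using g(2)[rule_format, of "case_option s y"] by simp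
  ultimately show ?thesis using that[OF g(1)] by blast
qed

text \<open>The leading form of a relation between the \<open>F c\<close> at \<open>F x\<close> vanishes on the image of the
  derivative of \<open>F\<close> at \<open>x\<close>, which is everything.\<close>

lemma submersion_at_imp_alg_independent:
  assumes fin: "finite C" "finite I" and F: "\<And>c. c \<in> C \<Longrightarrow> F c \<in> poly_funs I"
    and sub: "submersion_at C F x"
  shows "alg_independent C F"
proof (rule alg_independentI, rule ccontr)
  fix q y
  assume q: "q \<in> poly_funs C" "\<And>x. q (\<lambda>c. F c x) = 0" "q y \<noteq> 0"
  obtain g e v where g: "g \<in> poly_funs (insert None (Some ` C))"
    "\<forall>s y. q (\<lambda>c. F c x + s * y c) = s ^ e * g (case_option s y)" "g (case_option 0 v) \<noteq> 0"
    by (rule poly_funs_leading_form[of q C y "\<lambda>c. F c x", OF q(1,3)])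
  have "\<exists>w. \<forall>c\<in>C. dir_deriv (F c) x w = v c"
    by (rule submersion_at_surjective[OF fin _ sub]) (rule F)
  then obtain w where w: "\<forall>c\<in>C. dir_deriv (F c) x w = v c" by blast
  define slope where "slope s c = (F c (\<lambda>i. x i + s * w i) - F c x) / s" for s c
  have "g (case_option s (slope s)) = 0" if "s \<noteq> 0" for s
  proof -
    have "s ^ e * g (case_option s (slope s)) = q (\<lambda>c. F c x + s * slope s c)" using g(2) by simp
    also have "\<dots> = q (\<lambda>c. F c (\<lambda>i. x i + s * w i))" using that by (simp add: slope_def)
    finally show ?thesis using q(2) that by simp
  qed
  then have "((\<lambda>s. g (case_option s (slope s))) \<longlongrightarrow> 0) (at 0)"
    by (intro tendsto_eventually) (auto simp: eventually_at_filter)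
  moreover have "((\<lambda>s. g (case_option s (slope s))) \<longlongrightarrow> g (case_option 0 v)) (at 0)"
  proof (rule poly_funs_tendsto[OF g(1)])
    fix a assume "a \<in> insert None (Some ` C)"
    then show "((\<lambda>s. case_option s (slope s) a) \<longlongrightarrow> case_option 0 v a) (at 0)"
    proof (elim insertE imageE)
      fix c assume c: "c \<in> C" "a = Some c"
      have "((\<lambda>s. slope s c) \<longlongrightarrow> v c) (at 0)"
        using poly_funs_has_dir_deriv[OF F[OF c(1)], of x w] c(1) w
        by (simp add: DERIV_def slope_def)
      then show ?thesis using c(2) by simp
    qed simp
  qed
  ultimately show False using g(3) tendsto_unique[OF trivial_limit_at] by blast
qed

lemma alg_independent_relation_not_const:
  assumes indep: "alg_independent B F" and q: "q \<in> poly_funs (insert a B)" "q z \<noteq> 0"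
    and rel: "\<And>x. q (\<lambda>b. F b x) = 0"
  shows "\<not> degree_in_le a 0 q"
proof
  assume "degree_in_le a 0 q"
  then have const: "q (y(a := 0)) = q y" for y by (rule degree_in_le_0_const)
  have "q (z(a := 0)) = 0"
    by (rule alg_independentD[OF indep poly_funs_fix_coord[OF q(1)]]) (simp only: const rel)
  then show False using q(2) const by simp
qed

lemma relation_dir_deriv_times_partial_eq_0:
  assumes fin: "finite B" and F: "\<And>b. b \<in> insert a B \<Longrightarrow> F b \<in> poly_funs I"
    and q: "q \<in> poly_funs (insert a B)" "\<And>x. q (\<lambda>b. F b x) = 0"
    and stationary: "\<And>b. b \<in> B \<Longrightarrow> dir_deriv (F b) x w = 0"
  shows "dir_deriv (F a) x w * dir_deriv q (\<lambda>b. F b x) (indicator {a}) = 0"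
proof (cases "a \<in> B")
  case False
  let ?D = "\<lambda>b. dir_deriv q (\<lambda>b. F b x) (indicator {b})"
  have "0 = dir_deriv (\<lambda>x. q (\<lambda>b. F b x)) x w" by (simp add: q(2) dir_deriv_const)
  also have "\<dots> = dir_deriv q (\<lambda>b. F b x) (\<lambda>b. dir_deriv (F b) x w)"
    by (rule dir_deriv_compose[OF q(1) F])
  also have "\<dots> = (\<Sum>b\<in>insert a B. dir_deriv (F b) x w * ?D b)"
    using fin by (intro dir_deriv_eq_sum_partial[OF q(1)]) simp
  also have "\<dots> = dir_deriv (F a) x w * ?D a"
    using fin False stationary by (simp add: sum.neutral)
  finally show ?thesis by simp
qed (simp add: stationary)

text \<open>In characteristic zero a relation of minimal degree for \<open>F a\<close> over the other \<open>F b\<close> has a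
  partial derivative in \<open>a\<close> that does not vanish identically along \<open>F\<close>.\<close>

lemma algebraic_imp_generically_stationary:
  assumes fin: "finite B" and F: "\<And>b. b \<in> insert a B \<Longrightarrow> F b \<in> poly_funs I"
    and indep: "alg_independent B F" and dep: "\<not> alg_independent (insert a B) F"
  shows "generically I (\<lambda>x. \<forall>w. (\<forall>b\<in>B. dir_deriv (F b) x w = 0) \<longrightarrow> dir_deriv (F a) x w = 0)"
proof -
  have "?thesis" if "degree_in_le a d q" "q \<in> poly_funs (insert a B)" "q z \<noteq> 0"
    and "\<And>x. q (\<lambda>b. F b x) = 0" for d q z
    using that
  proof (induction d arbitrary: q z)
    case 0
    then show ?case using alg_independent_relation_not_const[OF indep] by blast
  next
    case (Suc d)
    define q' where "q' y = dir_deriv q y (indicator {a})" for y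
    have q': "q' \<in> poly_funs (insert a B)" "degree_in_le a d q'"
      unfolding q'_def[abs_def]
      using poly_funs_dir_deriv[OF Suc.prems(2)] degree_in_le_dir_deriv[OF Suc.prems(1)] by simp_all
    obtain y where "q' y \<noteq> 0"
      using alg_independent_relation_not_const[OF indep Suc.prems(2,3,4)]
        dir_deriv_zero_imp_degree_in_le_0[OF Suc.prems(2), of a] unfolding q'_def by blast
    show ?case
    proof (cases "\<exists>x. q' (\<lambda>b. F b x) \<noteq> 0")
      case True
      then obtain x\<^sub>0 where x\<^sub>0: "q' (\<lambda>b. F b x\<^sub>0) \<noteq> 0" by blast
      have "(\<lambda>x. q' (\<lambda>b. F b x)) \<in> poly_funs I" by (rule poly_funs_compose[OF q'(1) F])
      then show ?thesis using x\<^sub>0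
      proof (rule genericallyI, intro allI impI)
        fix x w assume "q' (\<lambda>b. F b x) \<noteq> 0" "\<forall>b\<in>B. dir_deriv (F b) x w = 0"
        then show "dir_deriv (F a) x w = 0"
          using relation_dir_deriv_times_partial_eq_0[OF fin F Suc.prems(2,4), of x w]
          unfolding q'_def by simp
      qed
    next
      case False
      show ?thesis by (rule Suc.IH[OF q'(2,1) \<open>q' y \<noteq> 0\<close>]) (use False in blast)
    qed
  qed
  moreover obtain q z where "q \<in> poly_funs (insert a B)" "\<And>x. q (\<lambda>b. F b x) = 0" "q z \<noteq> 0"
    using dep alg_independentI by metis
  moreover obtain d where "degree_in_le a d q" using poly_funs_degree_in_le calculation(2) by blast
  ultimately show ?thesis by blast
qed

lemma injective_dir_deriv_imp_submersion_at:
  assumes fin: "finite C" "finite I" and F: "\<And>c. c \<in> C \<Longrightarrow> F c \<in> poly_funs I"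
    and card: "card C \<le> card I"
    and inj: "\<And>w. (\<And>c. c \<in> C \<Longrightarrow> dir_deriv (F c) x w = 0) \<Longrightarrow> \<forall>i\<in>I. w i = 0"
  shows "submersion_at C F x"
  unfolding submersion_at_def
proof (intro allI impI)
  let ?D = "\<lambda>c i. dir_deriv (F c) x (indicator {i})"
  fix u assume u: "\<forall>w. (\<Sum>c\<in>C. u c * dir_deriv (F c) x w) = 0"
  show "\<forall>c\<in>C. u c = 0"
  proof (rule injective_imp_independent_rows[OF fin card, of ?D])
    fix w assume "\<And>c. c \<in> C \<Longrightarrow> (\<Sum>i\<in>I. w i * ?D c i) = 0"
    then show "\<forall>i\<in>I. w i = 0"
      by (intro inj) (subst dir_deriv_eq_sum_partial[OF F fin(2)])
  qed (use u in blast)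
qed

lemma submersion_at_Inl:
  assumes fin: "finite C" "finite D" and sub: "submersion_at (C <+> D) (case_sum F G) x"
  shows "submersion_at C F x"
  unfolding submersion_at_def
proof (intro allI impI)
  fix u assume u: "\<forall>w. (\<Sum>c\<in>C. u c * dir_deriv (F c) x w) = 0"
  let ?u = "case_sum u (\<lambda>_. 0)"
  have "(\<Sum>c\<in>C <+> D. ?u c * dir_deriv (case_sum F G c) x w) = 0" for w
    using fin u by (simp add: sum.Plus)
  then have "\<forall>c\<in>C <+> D. ?u c = 0" using sub unfolding submersion_at_def by blast
  then show "\<forall>c\<in>C. u c = 0" by (metis InlI sum.case(1))
qed

lemma alg_independent_completion:
  assumes fin: "finite I" and indep: "alg_independent C F"
  obtains J where "J \<subseteq> I" "alg_independent (C <+> J) (case_sum F (\<lambda>i x. x i))"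
    "\<forall>i\<in>I - J. \<not> alg_independent (insert (Inr i) (C <+> J)) (case_sum F (\<lambda>i x. x i))"
proof -
  let ?G = "case_sum F (\<lambda>i x. x i)"
  define \<J> where "\<J> = {J. J \<subseteq> I \<and> alg_independent (C <+> J) ?G}"
  have "alg_independent (C <+> {}) ?G"
    using alg_independent_image[where f = Inl and C = C and F = ?G] indep by (simp add: Plus_def)
  then have "{} \<in> \<J>" by (simp add: \<J>_def)
  moreover have "finite \<J>" using fin by (auto simp: \<J>_def intro: finite_subset[of _ "Pow I"])
  ultimately obtain J where J: "J \<in> \<J>" "\<And>J'. J' \<in> \<J> \<Longrightarrow> J \<subseteq> J' \<Longrightarrow> J = J'"
    using finite_has_maximal[of \<J>] by auto
  show ?thesis
  proof (rule that)
    show "J \<subseteq> I" "alg_independent (C <+> J) ?G" using J(1) by (auto simp: \<J>_def)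
    show "\<forall>i\<in>I - J. \<not> alg_independent (insert (Inr i) (C <+> J)) ?G"
    proof
      fix i assume i: "i \<in> I - J"
      then have "insert i J \<notin> \<J>" using J(2)[of "insert i J"] by auto
      moreover have "C <+> insert i J = insert (Inr i) (C <+> J)" by auto
      ultimately show "\<not> alg_independent (insert (Inr i) (C <+> J)) ?G"
        using i \<open>J \<subseteq> I\<close> by (auto simp: \<J>_def)
    qed
  qed
qed

text \<open>Complete \<open>F\<close> by coordinates to a maximal algebraically independent family. Every other
  coordinate is algebraic over it, so generically the derivative of the completed map is
  injective.\<close>

lemma alg_independent_imp_generically_submersion:
  assumes fin: "finite C" "finite I" and F: "\<And>c. c \<in> C \<Longrightarrow> F c \<in> poly_funs I"
    and indep: "alg_independent C F"
  shows "generically I (submersion_at C F)"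
proof -
  let ?G = "case_sum F (\<lambda>i x. x i)"
  obtain J where J: "J \<subseteq> I" "alg_independent (C <+> J) ?G"
    "\<forall>i\<in>I - J. \<not> alg_independent (insert (Inr i) (C <+> J)) ?G"
    by (rule alg_independent_completion[OF fin(2) indep])
  let ?B = "C <+> J"
  have finJ: "finite J" "finite ?B" using fin J(1) finite_subset by auto
  have completed: "?G b \<in> poly_funs I" if "b \<in> ?B \<or> b \<in> Inr ` I" for b
    using that J(1) F by (auto intro!: poly_funs.coord)
  have card: "card ?B \<le> card I"
    using fin(2) finJ(2) J(2) completed by (intro alg_independent_card_le) auto
  have "generically I (\<lambda>x. \<forall>i\<in>I - J. \<forall>w. (\<forall>b\<in>?B. dir_deriv (?G b) x w = 0) \<longrightarrow>
      dir_deriv (?G (Inr i)) x w = 0)"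
    using fin(2) finJ(2) completed J(2,3)
    by (intro generically_ball algebraic_imp_generically_stationary) auto
  then show ?thesis
  proof (rule generically_mono)
    fix x
    assume stationary: "\<forall>i\<in>I - J. \<forall>w. (\<forall>b\<in>?B. dir_deriv (?G b) x w = 0) \<longrightarrow>
      dir_deriv (?G (Inr i)) x w = 0"
    have "submersion_at ?B ?G x"
    proof (rule injective_dir_deriv_imp_submersion_at[OF finJ(2) fin(2) _ card])
      fix w assume w: "\<And>b. b \<in> ?B \<Longrightarrow> dir_deriv (?G b) x w = 0"
      then have "dir_deriv (?G (Inr i)) x w = 0" if "i \<in> I" for i
        using stationary that by (cases "i \<in> J") blast+
      then show "\<forall>i\<in>I. w i = 0" by (simp add: dir_deriv_coord)
    qed (use completed in blast)
    then show "submersion_at C F x" by (rule submersion_at_Inl[OF fin(1) finJ(1)])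
  qed
qed

section \<open>Generic properties hold almost everywhere\<close>

lemma (in product_sigma_finite) AE_PiM_insertI:
  assumes I: "finite I" "i \<notin> I"
    and P[measurable]: "Measurable.pred (PiM (insert i I) M) P"
    and AE: "AE x in PiM I M. AE t in M i. P (x(i := t))"
  shows "AE x in PiM (insert i I) M. P x"
proof -
  let ?N = "indicator {x. \<not> P x} :: _ \<Rightarrow> ennreal"
  have meas: "?N \<in> borel_measurable (PiM (insert i I) M)" by measurable
  have "(\<integral>\<^sup>+ x. ?N x \<partial>PiM (insert i I) M) = (\<integral>\<^sup>+ x. \<integral>\<^sup>+ t. ?N (x(i := t)) \<partial>M i \<partial>PiM I M)"
    by (rule product_nn_integral_insert[OF I meas])
  also have "\<dots> = (\<integral>\<^sup>+ x. 0 \<partial>PiM I M)"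
  proof (rule nn_integral_cong_AE)
    show "AE x in PiM I M. (\<integral>\<^sup>+ t. ?N (x(i := t)) \<partial>M i) = 0"
      using AE
    proof eventually_elim
      case (elim x)
      then have "(\<integral>\<^sup>+ t. ?N (x(i := t)) \<partial>M i) = (\<integral>\<^sup>+ t. 0 \<partial>M i)"
        by (intro nn_integral_cong_AE) (auto elim!: eventually_mono)
      then show ?case by simp
    qed
  qed
  finally have "AE x in PiM (insert i I) M. ?N x = 0" using nn_integral_0_iff_AE[OF meas] by simp
  then show ?thesis by eventually_elim (simp add: indicator_eq_0_iff)
qed

lemma poly_funs_measurable:
  assumes "f \<in> poly_funs I"
  shows "f \<in> borel_measurable (PiM I (\<lambda>_. lborel))"
  using assms
proof induction
  case (coord i)
  then have "(\<lambda>x. x i) \<in> measurable (PiM I (\<lambda>_. lborel :: real measure)) lborel"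
    by (rule measurable_component_singleton)
  then show ?case by simp
qed auto

lemma poly_funs_AE_nonzero:
  assumes "finite I" "f \<in> poly_funs I" "f z \<noteq> 0"
  shows "AE x in PiM I (\<lambda>_. lborel). f x \<noteq> 0"
  using assms
proof (induction I arbitrary: f)
  case empty
  have "f x \<noteq> 0" for x using poly_funs_cong[OF empty(1), of x z] empty(2) by simp
  then show ?case by simp
next
  case (insert i I)
  interpret product_sigma_finite "\<lambda>_. lborel :: real measure" by standard
  have "AE x in PiM I (\<lambda>_. lborel). f (x(i := z i)) \<noteq> 0"
    using insert.prems by (intro insert.IH poly_funs_fix_coord) simp_all
  then have "AE x in PiM I (\<lambda>_. lborel). AE t in lborel. f (x(i := t)) \<noteq> 0"
  proof eventually_elim
    case (elim x)
    obtain p where p: "\<And>t. f (x(i := t)) = poly p t"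
      using poly_funs_degree_in_le[OF insert.prems(1)] degree_in_leE by metis
    then have "p \<noteq> 0" using elim by auto
    then have "AE t in lborel. t \<notin> {t. poly p t = 0}"
      by (intro AE_not_in finite_imp_null_set_lborel poly_roots_finite)
    then show ?case by (simp add: p)
  qed
  moreover have "Measurable.pred (PiM (insert i I) (\<lambda>_. lborel)) (\<lambda>x. f x \<noteq> 0)"
    using poly_funs_measurable[OF insert.prems(1)] by measurable
  ultimately show ?case by (intro AE_PiM_insertI insert.hyps)
qed

lemma generically_imp_AE:
  assumes "finite I" "generically I P"
  shows "AE x in PiM I (\<lambda>_. lborel). P x"
proof -
  obtain h z where h: "h \<in> poly_funs I" "h z \<noteq> 0" "\<And>x. h x \<noteq> 0 \<Longrightarrow> P x"
    using assms(2) unfolding generically_def by blast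
  show ?thesis using poly_funs_AE_nonzero[OF assms(1) h(1,2)] by eventually_elim (rule h(3))
qed

lemma AE_PiM_lborel_imp_ex:
  assumes "finite I" "AE x in PiM I (\<lambda>_. lborel :: real measure). P x"
  shows "\<exists>x. P x"
proof -
  interpret product_sigma_finite "\<lambda>_. lborel :: real measure" by standard
  let ?M = "PiM I (\<lambda>_. lborel :: real measure)"
  have "emeasure ?M (Pi\<^sub>E I (\<lambda>_. {0..1})) = 1"
    using emeasure_PiM[OF assms(1), of "\<lambda>_. {0..1}"] by simp
  then have "ae_filter ?M \<noteq> bot"
    unfolding ae_filter_eq_bot_iff using emeasure_space[of ?M "Pi\<^sub>E I (\<lambda>_. {0..1})"] by auto
  then show ?thesis using assms(2) by (rule eventually_happens')
qed

section \<open>The Frobenius inner product\<close>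

definition mat_inner :: "nat \<Rightarrow> nat \<Rightarrow> real mat \<Rightarrow> real mat \<Rightarrow> real" where
  "mat_inner n m A B = (\<Sum>i<n. \<Sum>j<m. A $$ (i, j) * B $$ (i, j))"

lemma mat_inner_commute: "mat_inner n m A B = mat_inner n m B A"
  by (simp add: mat_inner_def mult.commute)

lemma mat_inner_add_left:
  assumes "A \<in> carrier_mat n m" "B \<in> carrier_mat n m"
  shows "mat_inner n m (A + B) C = mat_inner n m A C + mat_inner n m B C"
  using assms by (simp add: mat_inner_def distrib_right sum.distrib)

lemma mat_inner_smult_left:
  assumes "A \<in> carrier_mat n m"
  shows "mat_inner n m (s \<cdot>\<^sub>m A) B = s * mat_inner n m A B"
  using assms by (simp add: mat_inner_def sum_distrib_left mult.assoc)

lemma mat_inner_add_right: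
  assumes "B \<in> carrier_mat n m" "C \<in> carrier_mat n m"
  shows "mat_inner n m A (B + C) = mat_inner n m A B + mat_inner n m A C"
  using mat_inner_add_left[OF assms] by (simp add: mat_inner_commute[of n m A])

lemma mat_inner_smult_right:
  assumes "B \<in> carrier_mat n m"
  shows "mat_inner n m A (s \<cdot>\<^sub>m B) = s * mat_inner n m A B"
  using mat_inner_smult_left[OF assms] by (simp add: mat_inner_commute[of n m A])

lemma mat_inner_transpose:
  assumes "A \<in> carrier_mat n m" "B \<in> carrier_mat n m"
  shows "mat_inner m n A\<^sup>T B\<^sup>T = mat_inner n m A B"
  using assms by (simp add: mat_inner_def sum.swap[of _ "{..<n}"])

lemma mat_inner_mult_right:
  assumes "A \<in> carrier_mat n k" "B \<in> carrier_mat k m" "C \<in> carrier_mat n m"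
  shows "mat_inner n m C (A * B) = mat_inner k m (A\<^sup>T * C) B"
proof -
  have "mat_inner n m C (A * B) = (\<Sum>i<n. \<Sum>j<m. \<Sum>l<k. C $$ (i, j) * A $$ (i, l) * B $$ (l, j))"
    using assms
    by (simp add: mat_inner_def scalar_prod_def lessThan_atLeast0 sum_distrib_left mult.assoc)
  also have "\<dots> = (\<Sum>i<n. \<Sum>l<k. \<Sum>j<m. C $$ (i, j) * A $$ (i, l) * B $$ (l, j))"
    by (intro sum.cong refl sum.swap)
  also have "\<dots> = (\<Sum>l<k. \<Sum>i<n. \<Sum>j<m. C $$ (i, j) * A $$ (i, l) * B $$ (l, j))"
    by (rule sum.swap)
  also have "\<dots> = (\<Sum>l<k. \<Sum>j<m. \<Sum>i<n. C $$ (i, j) * A $$ (i, l) * B $$ (l, j))"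
    by (intro sum.cong refl sum.swap)
  also have "\<dots> = mat_inner k m (A\<^sup>T * C) B"
    using assms
    by (simp add: mat_inner_def scalar_prod_def lessThan_atLeast0 sum_distrib_left mult_ac)
  finally show ?thesis .
qed

lemma mat_inner_mult_left:
  assumes A: "A \<in> carrier_mat n k" and B: "B \<in> carrier_mat k m" and C: "C \<in> carrier_mat n m"
  shows "mat_inner n m (A * B) C = mat_inner n k A (C * B\<^sup>T)"
proof -
  have "mat_inner n m (A * B) C = mat_inner m n (B\<^sup>T * A\<^sup>T) C\<^sup>T"
    using mat_inner_transpose[of "A * B" n m C] A B C by (simp add: transpose_mult)
  also have "\<dots> = mat_inner k n (B * C\<^sup>T) A\<^sup>T"
    using mat_inner_mult_right[of "B\<^sup>T" m k "A\<^sup>T" n "C\<^sup>T"] A B C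
    by (subst mat_inner_commute) simp
  also have "\<dots> = mat_inner n k (C * B\<^sup>T) A"
    using mat_inner_transpose[of "B * C\<^sup>T" k n "A\<^sup>T"] A B C by (simp add: transpose_mult[of B k m])
  finally show ?thesis by (simp add: mat_inner_commute)
qed

lemma mat_inner_self_eq_0:
  assumes "A \<in> carrier_mat n m" "mat_inner n m A A = 0"
  shows "A = 0\<^sub>m n m"
proof -
  have "\<forall>i<n. \<forall>j<m. A $$ (i, j) = 0"
    using assms(2) unfolding mat_inner_def
    by (subst (asm) sum_nonneg_eq_0_iff; simp add: sum_nonneg sum_nonneg_eq_0_iff)
  then show ?thesis using assms(1) by (intro eq_matI) auto
qed

section \<open>Symmetric matrices supported on a graph\<close>

lemma sym_matsD:
  assumes "A \<in> sym_mats m"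
  shows "A \<in> carrier_mat m m" "A\<^sup>T = A"
  using assms by (auto simp: sym_mats_def)

lemma sym_mats_entry:
  assumes "A \<in> sym_mats m" "i < m" "j < m"
  shows "A $$ (j, i) = A $$ (i, j)"
  using sym_matsD[OF assms(1)] assms(2,3) by (metis carrier_matD index_transpose_mat(1))

lemma sym_mats_add:
  assumes "A \<in> sym_mats m" "B \<in> sym_mats m"
  shows "A + B \<in> sym_mats m"
  using assms by (auto simp: sym_mats_def transpose_add)

lemma sym_mats_smult:
  assumes "A \<in> sym_mats m"
  shows "s \<cdot>\<^sub>m A \<in> sym_mats m"
  using assms by (auto simp: sym_mats_def intro!: eq_matI sym_mats_entry[OF assms])

lemma sym_mats_congruence:
  assumes "N \<in> sym_mats n" "P \<in> carrier_mat n m"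
  shows "P\<^sup>T * N * P \<in> sym_mats m"
proof -
  note N = sym_matsD[OF assms(1)]
  have "(P\<^sup>T * N * P)\<^sup>T = P\<^sup>T * (P\<^sup>T * N)\<^sup>T" using N assms(2) by (intro transpose_mult) auto
  also have "(P\<^sup>T * N)\<^sup>T = N * P" using transpose_mult[of "P\<^sup>T" m n N n] N assms(2) by simp
  also have "P\<^sup>T * (N * P) = P\<^sup>T * N * P" using N assms(2) by simp
  finally show ?thesis using N assms(2) by (simp add: sym_mats_def)
qed

lemma L_space_subset_sym_mats: "K \<in> L_space m E \<Longrightarrow> K \<in> sym_mats m"
  by (simp add: L_space_def)

lemma L_space_add:
  assumes "K \<in> L_space m E" "K' \<in> L_space m E"
  shows "K + K' \<in> L_space m E"
proof -
  have "K + K' \<in> sym_mats m" "K' \<in> carrier_mat m m"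
    using assms by (simp_all add: L_space_def sym_mats_add sym_matsD(1))
  then show ?thesis using assms by (simp add: L_space_def)
qed

lemma L_space_smult:
  assumes "K \<in> L_space m E"
  shows "s \<cdot>\<^sub>m K \<in> L_space m E"
proof -
  have "s \<cdot>\<^sub>m K \<in> sym_mats m" "K \<in> carrier_mat m m"
    using assms by (simp_all add: L_space_def sym_mats_smult sym_matsD(1))
  then show ?thesis using assms by (simp add: L_space_def)
qed

definition entry_coord :: "nat \<Rightarrow> nat \<Rightarrow> nat + nat set" where
  "entry_coord i j = (if i = j then Inl i else Inr {i, j})"

lemma entry_coord_commute: "entry_coord i j = entry_coord j i"
  by (auto simp: entry_coord_def insert_commute)

lemma entry_coord_in_coords:
  assumes "i < m" "j < m"
  shows "entry_coord i j \<in> coords m E \<longleftrightarrow> i = j \<or> {i, j} \<in> E"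
  using assms by (auto simp: entry_coord_def coords_def)

lemma coords_entry_coord:
  assumes "simple_graph m E" "c \<in> coords m E"
  obtains i j where "i < m" "j < m" "c = entry_coord i j"
proof (cases c)
  case (Inl i)
  then show ?thesis using assms that[of i i] by (auto simp: coords_def entry_coord_def)
next
  case (Inr e)
  then have "e \<in> E" using assms by (auto simp: coords_def)
  then obtain i j where "i < m" "j < m" "i \<noteq> j" "e = {i, j}"
    using assms unfolding simple_graph_def by blast
  then show ?thesis using Inr that[of i j] by (auto simp: entry_coord_def)
qed

lemma simple_graph_finite: "simple_graph m E \<Longrightarrow> finite E"
  unfolding simple_graph_def by (rule finite_subset[of _ "Pow {..<m}"]) auto

lemma finite_coords: "simple_graph m E \<Longrightarrow> finite (coords m E)"
  by (simp add: coords_def simple_graph_finite)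

lemma card_coords: "simple_graph m E \<Longrightarrow> card (coords m E) = card {..<m} + card E"
  unfolding coords_def by (simp add: card_Plus simple_graph_finite)

lemma phi_entry_coord:
  assumes A: "A \<in> sym_mats m" and ij: "i < m" "j < m" "entry_coord i j \<in> coords m E"
  shows "phi m E A (entry_coord i j) = A $$ (i, j)"
proof (cases "i = j")
  case True
  then show ?thesis using ij by (simp add: phi_def entry_coord_def)
next
  case False
  then have "{Min {i, j}, Max {i, j}} = {i, j}" "Min {i, j} < Max {i, j}"
    by (auto simp: min_def max_def)
  then have "(Min {i, j}, Max {i, j}) = (i, j) \<or> (Min {i, j}, Max {i, j}) = (j, i)"
    by (auto simp: doubleton_eq_iff)
  then show ?thesis
    using False ij sym_mats_entry[OF A ij(1,2)] by (auto simp: phi_def entry_coord_def)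
qed

lemma phi_eq_iff:
  assumes graph: "simple_graph m E" and AB: "A \<in> sym_mats m" "B \<in> sym_mats m"
  shows "(\<forall>c\<in>coords m E. phi m E A c = phi m E B c) \<longleftrightarrow>
    (\<forall>i<m. \<forall>j<m. i = j \<or> {i, j} \<in> E \<longrightarrow> A $$ (i, j) = B $$ (i, j))" (is "_ \<longleftrightarrow> ?entries")
proof
  assume phi: "\<forall>c\<in>coords m E. phi m E A c = phi m E B c"
  show ?entries
  proof (intro allI impI)
    fix i j assume ij: "i < m" "j < m" "i = j \<or> {i, j} \<in> E"
    then have "entry_coord i j \<in> coords m E" by (simp add: entry_coord_in_coords)
    then show "A $$ (i, j) = B $$ (i, j)" using phi AB ij(1,2) by (metis phi_entry_coord)
  qed
next
  assume entries: ?entries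
  show "\<forall>c\<in>coords m E. phi m E A c = phi m E B c"
  proof
    fix c assume c: "c \<in> coords m E"
    obtain i j where "i < m" "j < m" "c = entry_coord i j" by (rule coords_entry_coord[OF graph c])
    then show "phi m E A c = phi m E B c"
      using c entries AB by (auto simp: phi_entry_coord entry_coord_in_coords)
  qed
qed

lemma phi_add:
  assumes graph: "simple_graph m E" and AB: "A \<in> sym_mats m" "B \<in> sym_mats m"
    and c: "c \<in> coords m E"
  shows "phi m E (A + B) c = phi m E A c + phi m E B c"
proof -
  obtain i j where "i < m" "j < m" "c = entry_coord i j" by (rule coords_entry_coord[OF graph c])
  then show ?thesis
    using c AB sym_mats_add[OF AB] sym_matsD(1)[OF AB(2)] by (simp add: phi_entry_coord)
qed

lemma phi_smult:
  assumes graph: "simple_graph m E" and A: "A \<in> sym_mats m" and c: "c \<in> coords m E"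
  shows "phi m E (s \<cdot>\<^sub>m A) c = s * phi m E A c"
proof -
  obtain i j where "i < m" "j < m" "c = entry_coord i j" by (rule coords_entry_coord[OF graph c])
  then show ?thesis
    using c A sym_mats_smult[OF A] sym_matsD(1)[OF A] by (simp add: phi_entry_coord)
qed

definition coord_multiplicity :: "nat \<Rightarrow> nat + nat set \<Rightarrow> nat" where
  "coord_multiplicity m c = card {z \<in> {..<m} \<times> {..<m}. entry_coord (fst z) (snd z) = c}"

lemma coord_multiplicity_pos:
  assumes "simple_graph m E" "c \<in> coords m E"
  shows "coord_multiplicity m c > 0"
proof -
  obtain i j where "i < m" "j < m" "c = entry_coord i j" by (rule coords_entry_coord[OF assms])
  then have "(i, j) \<in> {z \<in> {..<m} \<times> {..<m}. entry_coord (fst z) (snd z) = c}" by simp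
  then show ?thesis unfolding coord_multiplicity_def by (auto simp: card_gt_0_iff)
qed

definition phi_adjoint :: "nat \<Rightarrow> nat set set \<Rightarrow> (nat + nat set \<Rightarrow> real) \<Rightarrow> real mat" where
  "phi_adjoint m E u = mat m m (\<lambda>(i, j). if i = j \<or> {i, j} \<in> E
     then u (entry_coord i j) / coord_multiplicity m (entry_coord i j) else 0)"

lemma phi_adjoint_entry:
  assumes "i < m" "j < m"
  shows "phi_adjoint m E u $$ (i, j) = (if entry_coord i j \<in> coords m E
    then u (entry_coord i j) / coord_multiplicity m (entry_coord i j) else 0)"
  using assms by (simp add: phi_adjoint_def entry_coord_in_coords)

lemma phi_adjoint_L_space: "phi_adjoint m E u \<in> L_space m E"
  unfolding L_space_def sym_mats_def phi_adjoint_def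
  by (auto intro!: eq_matI simp: entry_coord_commute insert_commute)

lemma phi_adjoint_add: "phi_adjoint m E (\<lambda>c. u c + v c) = phi_adjoint m E u + phi_adjoint m E v"
  unfolding phi_adjoint_def by (rule eq_matI) (auto simp: add_divide_distrib)

lemma phi_adjoint_smult: "phi_adjoint m E (\<lambda>c. s * u c) = s \<cdot>\<^sub>m phi_adjoint m E u"
  unfolding phi_adjoint_def by (rule eq_matI) auto

lemma phi_adjoint_eq_0_iff:
  assumes graph: "simple_graph m E"
  shows "phi_adjoint m E u = 0\<^sub>m m m \<longleftrightarrow> (\<forall>c\<in>coords m E. u c = 0)"
proof
  assume zero: "phi_adjoint m E u = 0\<^sub>m m m"
  show "\<forall>c\<in>coords m E. u c = 0"
  proof
    fix c assume c: "c \<in> coords m E"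
    obtain i j where ij: "i < m" "j < m" "c = entry_coord i j"
      by (rule coords_entry_coord[OF graph c])
    then have "phi_adjoint m E u $$ (i, j) = u c / coord_multiplicity m c"
      using c by (simp add: phi_adjoint_entry)
    then show "u c = 0" using zero ij coord_multiplicity_pos[OF graph c] by simp
  qed
next
  assume "\<forall>c\<in>coords m E. u c = 0"
  then show "phi_adjoint m E u = 0\<^sub>m m m"
    unfolding phi_adjoint_def by (intro eq_matI) (auto simp: entry_coord_in_coords[symmetric])
qed

lemma L_space_eq_range_phi_adjoint:
  assumes graph: "simple_graph m E"
  shows "L_space m E = range (phi_adjoint m E)"
proof (intro equalityI subsetI)
  fix K assume K: "K \<in> L_space m E"
  let ?u = "\<lambda>c. phi m E K c * coord_multiplicity m c"
  have "K = phi_adjoint m E ?u"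
  proof (rule eq_matI)
    fix i j assume "i < dim_row (phi_adjoint m E ?u)" "j < dim_col (phi_adjoint m E ?u)"
    then have ij: "i < m" "j < m" by (simp_all add: phi_adjoint_def)
    show "K $$ (i, j) = phi_adjoint m E ?u $$ (i, j)"
    proof (cases "entry_coord i j \<in> coords m E")
      case True
      then show ?thesis
        using ij phi_entry_coord[OF L_space_subset_sym_mats[OF K]]
          coord_multiplicity_pos[OF graph True]
        by (simp add: phi_adjoint_entry)
    next
      case False
      then show ?thesis using K ij by (simp add: phi_adjoint_def entry_coord_in_coords L_space_def)
    qed
  qed (use sym_matsD(1)[OF L_space_subset_sym_mats[OF K]] in \<open>auto simp: phi_adjoint_def\<close>)
  then show "K \<in> range (phi_adjoint m E)" by blast
qed (auto simp: phi_adjoint_L_space)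

lemma mat_inner_phi_adjoint:
  assumes graph: "simple_graph m E" and A: "A \<in> sym_mats m"
  shows "mat_inner m m (phi_adjoint m E u) A = (\<Sum>c\<in>coords m E. u c * phi m E A c)"
proof -
  let ?e = "\<lambda>z. entry_coord (fst z) (snd z)" and ?V = "{..<m} \<times> {..<m}"
  let ?U = "{z \<in> ?V. ?e z \<in> coords m E}"
  have "mat_inner m m (phi_adjoint m E u) A = (\<Sum>z\<in>?V. phi_adjoint m E u $$ z * A $$ z)"
    by (simp add: mat_inner_def sum.cartesian_product case_prod_beta)
  also have "\<dots> = (\<Sum>z\<in>?U. phi_adjoint m E u $$ z * A $$ z)"
    by (rule sum.mono_neutral_right) (auto simp: phi_adjoint_entry split: if_splits)
  also have "\<dots> = (\<Sum>z\<in>?U. u (?e z) / coord_multiplicity m (?e z) * phi m E A (?e z))"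
    by (rule sum.cong) (auto simp: phi_adjoint_entry phi_entry_coord[OF A])
  also have "\<dots> = (\<Sum>c\<in>coords m E. \<Sum>z\<in>{z \<in> ?U. ?e z = c}.
      u (?e z) / coord_multiplicity m (?e z) * phi m E A (?e z))"
    by (rule sum.group[symmetric]) (auto simp: finite_coords[OF graph])
  also have "\<dots> = (\<Sum>c\<in>coords m E. u c * phi m E A c)"
  proof (rule sum.cong[OF refl])
    fix c assume c: "c \<in> coords m E"
    then have "{z \<in> ?U. ?e z = c} = {z \<in> ?V. ?e z = c}" by auto
    then have "(\<Sum>z\<in>{z \<in> ?U. ?e z = c}. u (?e z) / coord_multiplicity m (?e z) * phi m E A (?e z)) =
        coord_multiplicity m c * (u c / coord_multiplicity m c * phi m E A c)"
      by (simp add: coord_multiplicity_def)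
    then show "(\<Sum>z\<in>{z \<in> ?U. ?e z = c}. u (?e z) / coord_multiplicity m (?e z) * phi m E A (?e z)) =
        u c * phi m E A c"
      using coord_multiplicity_pos[OF graph c] by simp
  qed
  finally show ?thesis .
qed

section \<open>Polynomial maps into the symmetric matrices\<close>

definition poly_mats :: "'i set \<Rightarrow> nat \<Rightarrow> nat \<Rightarrow> (('i \<Rightarrow> real) \<Rightarrow> real mat) set" where
  "poly_mats I n m =
     {A. (\<forall>x. A x \<in> carrier_mat n m) \<and> (\<forall>i<n. \<forall>j<m. (\<lambda>x. A x $$ (i, j)) \<in> poly_funs I)}"

lemma poly_matsD:
  assumes "A \<in> poly_mats I n m"
  shows "A x \<in> carrier_mat n m" "dim_row (A x) = n" "dim_col (A x) = m"
    and "i < n \<Longrightarrow> j < m \<Longrightarrow> (\<lambda>x. A x $$ (i, j)) \<in> poly_funs I"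
  using assms by (auto simp: poly_mats_def)

lemma poly_matsI:
  assumes "\<And>x. A x \<in> carrier_mat n m" "\<And>i j. i < n \<Longrightarrow> j < m \<Longrightarrow> (\<lambda>x. A x $$ (i, j)) \<in> poly_funs I"
  shows "A \<in> poly_mats I n m"
  using assms by (simp add: poly_mats_def)

lemma poly_mats_coords:
  assumes "\<And>i j. i < n \<Longrightarrow> j < m \<Longrightarrow> \<iota> (i, j) \<in> I"
  shows "(\<lambda>x. mat n m (\<lambda>z. x (\<iota> z))) \<in> poly_mats I n m"
  using assms by (simp add: poly_mats_def poly_funs.coord)

lemma poly_mats_transpose:
  assumes "A \<in> poly_mats I n m"
  shows "(\<lambda>x. (A x)\<^sup>T) \<in> poly_mats I m n"
  using poly_matsD[OF assms] by (intro poly_matsI) simp_all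

lemma poly_mats_add:
  assumes "A \<in> poly_mats I n m" "B \<in> poly_mats I n m"
  shows "(\<lambda>x. A x + B x) \<in> poly_mats I n m"
  using poly_matsD[OF assms(1)] poly_matsD[OF assms(2)]
  by (intro poly_matsI) (simp_all add: poly_funs.add)

lemma poly_mats_mult:
  assumes A: "A \<in> poly_mats I n k" and B: "B \<in> poly_mats I k m"
  shows "(\<lambda>x. A x * B x) \<in> poly_mats I n m"
proof -
  note A = poly_matsD[OF A] and B = poly_matsD[OF B]
  have "(A x * B x) $$ (i, j) = (\<Sum>l<k. A x $$ (i, l) * B x $$ (l, j))" if "i < n" "j < m" for x i j
    using that A(2,3)[of x] B(2,3)[of x] by (simp add: scalar_prod_def lessThan_atLeast0)
  moreover have "(\<lambda>x. \<Sum>l<k. A x $$ (i, l) * B x $$ (l, j)) \<in> poly_funs I" if "i < n" "j < m" for i j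
    using that A(4) B(4) by (intro poly_funs_sum poly_funs.mult) simp_all
  ultimately show ?thesis using mult_carrier_mat[OF A(1) B(1)] by (intro poly_matsI) simp_all
qed

lemma phi_poly_funs:
  assumes graph: "simple_graph m E" and c: "c \<in> coords m E"
    and A: "A \<in> poly_mats I m m" "\<And>x. A x \<in> sym_mats m"
  shows "(\<lambda>x. phi m E (A x) c) \<in> poly_funs I"
proof -
  obtain i j where "i < m" "j < m" "c = entry_coord i j" by (rule coords_entry_coord[OF graph c])
  then show ?thesis using A(2) poly_matsD(4)[OF A(1)] c by (simp add: phi_entry_coord)
qed

lemma submersion_at_phi_iff:
  assumes graph: "simple_graph m E" and A: "A \<in> poly_mats I m m" "\<And>x. A x \<in> sym_mats m"
  shows "submersion_at (coords m E) (\<lambda>c x. phi m E (A x) c) x \<longleftrightarrow>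
    (\<forall>K\<in>L_space m E. (\<forall>w. dir_deriv (\<lambda>x. mat_inner m m K (A x)) x w = 0) \<longrightarrow> K = 0\<^sub>m m m)"
proof -
  have "dir_deriv (\<lambda>x. mat_inner m m (phi_adjoint m E u) (A x)) x w =
      (\<Sum>c\<in>coords m E. u c * dir_deriv (\<lambda>x. phi m E (A x) c) x w)" for u w
    unfolding mat_inner_phi_adjoint[OF graph A(2)]
    by (rule dir_deriv_linear_combination[OF phi_poly_funs[OF graph _ A]])
  then show ?thesis
    by (simp add: submersion_at_def L_space_eq_range_phi_adjoint[OF graph]
        phi_adjoint_eq_0_iff[OF graph])
qed

lemma alg_independent_phi:
  "alg_independent (coords m E) (\<lambda>c x. phi m E (A x) c) \<longleftrightarrow>
     zariski_dense (coords m E) (phi m E ` range A)"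
  by (simp add: alg_independent_def image_image)

lemma mat_line: "mat n m (\<lambda>z. x (\<iota> z) + s * w (\<iota> z)) =
    mat n m (\<lambda>z. x (\<iota> z)) + s \<cdot>\<^sub>m mat n m (\<lambda>z. w (\<iota> z))"
  by (rule eq_matI) auto

section \<open>Existence of the score matching estimator\<close>

definition regular :: "nat \<Rightarrow> nat set set \<Rightarrow> real mat \<Rightarrow> bool" where
  "regular m E P \<longleftrightarrow> (\<forall>K\<in>L_space m E. P * K = 0\<^sub>m (dim_row P) m \<longrightarrow> K = 0\<^sub>m m m)"

definition lyapunov :: "real mat \<Rightarrow> real mat \<Rightarrow> real mat" where
  "lyapunov P K = K * (P\<^sup>T * P) + P\<^sup>T * P * K"

lemma gram_sym:
  assumes "P \<in> carrier_mat n m"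
  shows "P\<^sup>T * P \<in> sym_mats m"
  using assms transpose_mult[of "P\<^sup>T" m n P m] by (simp add: sym_mats_def)

lemma lyapunov_sym:
  assumes P: "P \<in> carrier_mat n m" and K: "K \<in> sym_mats m"
  shows "lyapunov P K \<in> sym_mats m"
proof -
  note K = sym_matsD[OF K] and S = sym_matsD[OF gram_sym[OF P]]
  have "(K * (P\<^sup>T * P))\<^sup>T = P\<^sup>T * P * K" using transpose_mult[OF K(1) S(1)] K S by simp
  moreover have "(P\<^sup>T * P * K)\<^sup>T = K * (P\<^sup>T * P)" using transpose_mult[OF S(1) K(1)] K S by simp
  ultimately show ?thesis
    using K(1) S(1) transpose_add[of "K * (P\<^sup>T * P)" m m "P\<^sup>T * P * K"]
      comm_add_mat[of "K * (P\<^sup>T * P)" m m "P\<^sup>T * P * K"]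
    by (simp add: lyapunov_def sym_mats_def)
qed

lemma lyapunov_add:
  assumes P: "P \<in> carrier_mat n m" and K: "K \<in> carrier_mat m m" "K' \<in> carrier_mat m m"
  shows "lyapunov P (K + K') = lyapunov P K + lyapunov P K'"
proof -
  have S: "P\<^sup>T * P \<in> carrier_mat m m" using P by simp
  have "lyapunov P (K + K') = (K * (P\<^sup>T * P) + K' * (P\<^sup>T * P)) + (P\<^sup>T * P * K + P\<^sup>T * P * K')"
    using add_mult_distrib_mat[OF K S] mult_add_distrib_mat[OF S K] by (simp add: lyapunov_def)
  also have "\<dots> = lyapunov P K + lyapunov P K'"
    unfolding lyapunov_def using P K by (intro eq_matI) auto
  finally show ?thesis .
qed

lemma lyapunov_smult:
  assumes P: "P \<in> carrier_mat n m" and K: "K \<in> carrier_mat m m"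
  shows "lyapunov P (s \<cdot>\<^sub>m K) = s \<cdot>\<^sub>m lyapunov P K"
proof -
  have S: "P\<^sup>T * P \<in> carrier_mat m m" using P by simp
  show ?thesis
    using mult_smult_assoc_mat[OF K S] mult_smult_distrib[OF S K] S K
    by (simp add: lyapunov_def add_smult_distrib_left_mat[of _ m m])
qed

lemma phi_lyapunov_add:
  assumes "simple_graph m E" "c \<in> coords m E" "P \<in> carrier_mat n m"
    and "K \<in> sym_mats m" "K' \<in> sym_mats m"
  shows "phi m E (lyapunov P (K + K')) c = phi m E (lyapunov P K) c + phi m E (lyapunov P K') c"
  using assms by (simp add: lyapunov_add sym_matsD(1) phi_add lyapunov_sym)

lemma phi_lyapunov_smult:
  assumes "simple_graph m E" "c \<in> coords m E" "P \<in> carrier_mat n m" "K \<in> sym_mats m"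
  shows "phi m E (lyapunov P (s \<cdot>\<^sub>m K)) c = s * phi m E (lyapunov P K) c"
  using assms by (simp add: lyapunov_smult sym_matsD(1) phi_smult lyapunov_sym)

lemma mat_inner_lyapunov:
  assumes P: "P \<in> carrier_mat n m" and K: "K \<in> sym_mats m"
  shows "mat_inner m m K (lyapunov P K) = 2 * mat_inner n m (P * K) (P * K)"
proof -
  note K = sym_matsD[OF K] and S = sym_matsD[OF gram_sym[OF P]]
  have right: "mat_inner m m K (P\<^sup>T * P * K) = mat_inner n m (P * K) (P * K)"
    using mat_inner_mult_right[of "P\<^sup>T" m n "P * K" m K] P K(1) by simp
  have "(P\<^sup>T * P * K)\<^sup>T = K * (P\<^sup>T * P)" using transpose_mult[OF S(1) K(1)] K S by simp
  then have "mat_inner m m K (K * (P\<^sup>T * P)) = mat_inner m m K (P\<^sup>T * P * K)"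
    using mat_inner_transpose[of K m m "P\<^sup>T * P * K"] K S by simp
  then show ?thesis
    using right K(1) S(1) by (simp add: lyapunov_def mat_inner_add_right[of _ m m])
qed

lemma lyapunov_kernel_iff:
  assumes graph: "simple_graph m E" and P: "P \<in> carrier_mat n m" and K: "K \<in> L_space m E"
  shows "(\<forall>c\<in>coords m E. phi m E (lyapunov P K) c = 0) \<longleftrightarrow> P * K = 0\<^sub>m n m"
proof
  obtain u where u: "K = phi_adjoint m E u" using K L_space_eq_range_phi_adjoint[OF graph] by auto
  note K' = L_space_subset_sym_mats[OF K]
  assume "\<forall>c\<in>coords m E. phi m E (lyapunov P K) c = 0"
  then have "mat_inner m m K (lyapunov P K) = 0"
    unfolding u using mat_inner_phi_adjoint[OF graph lyapunov_sym[OF P K'], of u] by (simp add: u)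
  then show "P * K = 0\<^sub>m n m"
    using mat_inner_lyapunov[OF P K'] P sym_matsD(1)[OF K'] by (intro mat_inner_self_eq_0) auto
next
  note K' = sym_matsD[OF L_space_subset_sym_mats[OF K]]
  assume PK: "P * K = 0\<^sub>m n m"
  have "K * P\<^sup>T = (P * K)\<^sup>T" using transpose_mult[OF P K'(1)] K'(2) by simp
  then have "K * (P\<^sup>T * P) = 0\<^sub>m m m"
    using P K'(1) PK assoc_mult_mat[of K m m "P\<^sup>T" n P m] by simp
  moreover have "P\<^sup>T * P * K = 0\<^sub>m m m"
    using P K'(1) PK assoc_mult_mat[of "P\<^sup>T" m n P m K m] by simp
  ultimately have zero: "lyapunov P K = 0 \<cdot>\<^sub>m lyapunov P K" by (auto simp: lyapunov_def)
  show "\<forall>c\<in>coords m E. phi m E (lyapunov P K) c = 0"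
    by (subst zero) (simp add: phi_smult[OF graph lyapunov_sym[OF P L_space_subset_sym_mats[OF K]]])
qed

lemma regular_imp_lyapunov_surjective:
  assumes graph: "simple_graph m E" and P: "P \<in> carrier_mat n m" and reg: "regular m E P"
  shows "\<exists>K\<in>L_space m E. \<forall>c\<in>coords m E. phi m E (lyapunov P K) c = v c"
proof -
  have adjoint_sym: "phi_adjoint m E u \<in> sym_mats m" for u
    by (rule L_space_subset_sym_mats[OF phi_adjoint_L_space])
  have "\<exists>u. \<forall>c\<in>coords m E. phi m E (lyapunov P (phi_adjoint m E u)) c = v c"
  proof (rule linear_injective_imp_surjective[OF finite_coords[OF graph]])
    fix u assume "\<And>c. c \<in> coords m E \<Longrightarrow> phi m E (lyapunov P (phi_adjoint m E u)) c = 0"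
    then have "P * phi_adjoint m E u = 0\<^sub>m n m"
      using lyapunov_kernel_iff[OF graph P phi_adjoint_L_space] by blast
    then have "phi_adjoint m E u = 0\<^sub>m m m"
      using reg phi_adjoint_L_space P unfolding regular_def by auto
    then show "\<forall>c\<in>coords m E. u c = 0" by (simp add: phi_adjoint_eq_0_iff[OF graph])
  next
    fix u v c assume "c \<in> coords m E"
    then show "phi m E (lyapunov P (phi_adjoint m E (\<lambda>a. u a + v a))) c =
        phi m E (lyapunov P (phi_adjoint m E u)) c + phi m E (lyapunov P (phi_adjoint m E v)) c"
      by (simp add: phi_adjoint_add phi_lyapunov_add[OF graph _ P adjoint_sym adjoint_sym])
  next
    fix r u c assume "c \<in> coords m E"
    then show "phi m E (lyapunov P (phi_adjoint m E (\<lambda>a. r * u a))) c =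
        r * phi m E (lyapunov P (phi_adjoint m E u)) c"
      by (simp add: phi_adjoint_smult phi_lyapunov_smult[OF graph _ P adjoint_sym])
  qed
  then show ?thesis using phi_adjoint_L_space by blast
qed

lemma half_proj_L_eq_one_iff:
  assumes graph: "simple_graph m E" and A: "A \<in> sym_mats m"
  shows "(1/2) \<cdot>\<^sub>m proj_L m E A = 1\<^sub>m m \<longleftrightarrow>
    (\<forall>c\<in>coords m E. phi m E A c = phi m E (2 \<cdot>\<^sub>m 1\<^sub>m m) c)"
proof -
  have "2 \<cdot>\<^sub>m 1\<^sub>m m \<in> sym_mats m" by (intro sym_mats_smult) (simp add: sym_mats_def)
  then have "(\<forall>c\<in>coords m E. phi m E A c = phi m E (2 \<cdot>\<^sub>m 1\<^sub>m m) c) \<longleftrightarrow>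
      (\<forall>i<m. \<forall>j<m. i = j \<or> {i, j} \<in> E \<longrightarrow> A $$ (i, j) = (2 \<cdot>\<^sub>m 1\<^sub>m m) $$ (i, j))"
    by (rule phi_eq_iff[OF graph A])
  also have "\<dots> \<longleftrightarrow> (1/2) \<cdot>\<^sub>m proj_L m E A = 1\<^sub>m m"
    by (auto simp: proj_L_eq[OF A] mat_eq_iff)
  finally show ?thesis by (rule sym)
qed

lemma lyapunov_unique_solution_iff_regular:
  assumes graph: "simple_graph m E" and P: "P \<in> carrier_mat n m"
  shows "(\<exists>!K. K \<in> L_space m E \<and> (\<forall>c\<in>coords m E. phi m E (lyapunov P K) c = v c)) \<longleftrightarrow> regular m E P"
    (is "(\<exists>!K. ?solves K) \<longleftrightarrow> _")
proof
  assume unique: "\<exists>!K. ?solves K"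
  then obtain K where K: "?solves K" by blast
  show "regular m E P"
    unfolding regular_def
  proof (intro ballI impI)
    fix K\<^sub>0 assume K\<^sub>0: "K\<^sub>0 \<in> L_space m E" "P * K\<^sub>0 = 0\<^sub>m (dim_row P) m"
    then have "\<forall>c\<in>coords m E. phi m E (lyapunov P K\<^sub>0) c = 0"
      using lyapunov_kernel_iff[OF graph P K\<^sub>0(1)] P by simp
    moreover have K_sym: "K \<in> sym_mats m" "K\<^sub>0 \<in> sym_mats m"
      using K K\<^sub>0(1) by (auto intro: L_space_subset_sym_mats)
    ultimately have "?solves (K + K\<^sub>0)"
      using K K\<^sub>0(1) by (simp add: L_space_add phi_lyapunov_add[OF graph _ P])
    then have "K + K\<^sub>0 = K" using unique K by blast
    then show "K\<^sub>0 = 0\<^sub>m m m"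
      using K_sym[THEN sym_matsD(1)] by (auto simp: mat_eq_iff)
  qed
next
  assume reg: "regular m E P"
  then obtain K where K: "?solves K" using regular_imp_lyapunov_surjective[OF graph P] by blast
  show "\<exists>!K. ?solves K"
  proof (rule ex1I[of _ K])
    fix K' assume K': "?solves K'"
    let ?D = "K' + (-1) \<cdot>\<^sub>m K"
    have D: "?D \<in> L_space m E" using K K' by (simp add: L_space_add L_space_smult)
    have K_sym: "K \<in> sym_mats m" "K' \<in> sym_mats m"
      using K K' by (auto intro: L_space_subset_sym_mats)
    have "\<forall>c\<in>coords m E. phi m E (lyapunov P ?D) c = 0"
      using K K' K_sym
      by (simp add: sym_mats_smult phi_lyapunov_add[OF graph _ P] phi_lyapunov_smult[OF graph _ P])
    then have "?D = 0\<^sub>m m m"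
      using reg D P lyapunov_kernel_iff[OF graph P D] unfolding regular_def by auto
    then show "K' = K" using K_sym[THEN sym_matsD(1)] by (auto simp: mat_eq_iff)
  qed (rule K)
qed

lemma sme_exists_iff_regular:
  assumes graph: "simple_graph m E" and P: "P \<in> carrier_mat n m"
  shows "sme_exists m E P \<longleftrightarrow> regular m E P"
proof -
  have "(1/2) \<cdot>\<^sub>m proj_L m E (K * (P\<^sup>T * P)\<^sup>T + P\<^sup>T * P * K\<^sup>T) = 1\<^sub>m m \<longleftrightarrow>
      (\<forall>c\<in>coords m E. phi m E (lyapunov P K) c = phi m E (2 \<cdot>\<^sub>m 1\<^sub>m m) c)"
    if "K \<in> L_space m E" for K
  proof -
    note K = L_space_subset_sym_mats[OF that]
    have "K * (P\<^sup>T * P)\<^sup>T + P\<^sup>T * P * K\<^sup>T = lyapunov P K"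
      by (simp add: lyapunov_def sym_matsD(2)[OF K] sym_matsD(2)[OF gram_sym[OF P]])
    then show ?thesis using half_proj_L_eq_one_iff[OF graph lyapunov_sym[OF P K]] by simp
  qed
  then have "sme_exists m E P \<longleftrightarrow> (\<exists>!K. K \<in> L_space m E \<and>
      (\<forall>c\<in>coords m E. phi m E (lyapunov P K) c = phi m E (2 \<cdot>\<^sub>m 1\<^sub>m m) c))"
    unfolding sme_exists_def Let_def by (simp cong: conj_cong)
  then show ?thesis by (simp only: lyapunov_unique_solution_iff_regular[OF graph P])
qed

section \<open>Regular points of the Gram map\<close>

lemma mat_inner_gram_line:
  assumes K: "K \<in> sym_mats m" and P: "P \<in> carrier_mat n m" and W: "W \<in> carrier_mat n m"
  shows "mat_inner m m K ((P + s \<cdot>\<^sub>m W)\<^sup>T * (P + s \<cdot>\<^sub>m W)) =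
    mat_inner n m (P * K) P + s * (2 * mat_inner n m (P * K) W) + s\<^sup>2 * mat_inner n m (W * K) W"
proof -
  note K = sym_matsD[OF K]
  let ?Q = "P + s \<cdot>\<^sub>m W"
  have PW: "P * K \<in> carrier_mat n m" "W * K \<in> carrier_mat n m" using P W K(1) by simp_all
  have "mat_inner n m (W * K) P = mat_inner n m (P * K) W"
    using mat_inner_mult_left[OF W K(1) P] K(2) by (simp add: mat_inner_commute)
  moreover have "?Q * K = P * K + s \<cdot>\<^sub>m (W * K)"
    using P W K(1) by (simp add: add_mult_distrib_mat[of _ n m] mult_smult_assoc_mat[of _ n m])
  moreover have "mat_inner m m K (?Q\<^sup>T * ?Q) = mat_inner n m (?Q * K) ?Q"
    using mat_inner_mult_right[of "?Q\<^sup>T" m n ?Q m K] P W K(1) by simp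
  ultimately show ?thesis
    using P W PW
    by (simp add: mat_inner_add_left[of _ n m] mat_inner_add_right[of _ n m]
        mat_inner_smult_left[of _ n m] mat_inner_smult_right[of _ n m]
        algebra_simps power2_eq_square)
qed

lemma dir_deriv_mat_inner_gram:
  assumes K: "K \<in> sym_mats m"
  shows "dir_deriv (\<lambda>x. mat_inner m m K ((mat n m x)\<^sup>T * mat n m x)) x w =
    2 * mat_inner n m (mat n m x * K) (mat n m w)"
proof (rule dir_deriv_eqI)
  let ?P = "mat n m x" and ?W = "mat n m w"
  have "mat_inner m m K ((mat n m (\<lambda>z. x z + s * w z))\<^sup>T * mat n m (\<lambda>z. x z + s * w z)) =
      mat_inner n m (?P * K) ?P + s * (2 * mat_inner n m (?P * K) ?W) +
      s\<^sup>2 * mat_inner n m (?W * K) ?W" for s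
    using mat_inner_gram_line[OF K, of ?P n ?W s] mat_line[of n m x "\<lambda>z. z" s w] by simp
  moreover have "((\<lambda>s. a + s * b + s\<^sup>2 * c) has_real_derivative b) (at 0)" for a b c :: real
    by (auto intro!: derivative_eq_intros)
  ultimately show "((\<lambda>s. mat_inner m m K ((mat n m (\<lambda>z. x z + s * w z))\<^sup>T *
      mat n m (\<lambda>z. x z + s * w z))) has_real_derivative 2 * mat_inner n m (?P * K) ?W) (at 0)"
    by simp
qed

lemma regular_imp_gram_dense:
  assumes graph: "simple_graph m E" and reg: "regular m E (mat n m p)"
  shows "zariski_dense (coords m E) (phi m E ` range (\<lambda>x. (mat n m x)\<^sup>T * mat n m x))"
proof -
  let ?I = "{..<n} \<times> {..<m}" and ?gram = "\<lambda>x. (mat n m x)\<^sup>T * mat n m x"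
  have "(\<lambda>x. mat n m x) \<in> poly_mats ?I n m" using poly_mats_coords[of n m "\<lambda>z. z" ?I] by simp
  then have gram: "?gram \<in> poly_mats ?I m m" by (intro poly_mats_mult poly_mats_transpose)
  have gram_symmetric: "?gram x \<in> sym_mats m" for x by (rule gram_sym[of _ n]) simp
  have "submersion_at (coords m E) (\<lambda>c x. phi m E (?gram x) c) p"
    unfolding submersion_at_phi_iff[OF graph gram gram_symmetric]
  proof (intro ballI impI)
    fix K
    assume K: "K \<in> L_space m E" and zero: "\<forall>w. dir_deriv (\<lambda>x. mat_inner m m K (?gram x)) p w = 0"
    note K' = L_space_subset_sym_mats[OF K]
    let ?PK = "mat n m p * K"
    have "mat n m (\<lambda>z. ?PK $$ z) = ?PK" using sym_matsD(1)[OF K'] by (intro eq_matI) auto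
    then have "mat_inner n m ?PK ?PK = 0"
      using zero[rule_format, of "\<lambda>z. ?PK $$ z"] by (simp add: dir_deriv_mat_inner_gram[OF K'])
    then have "?PK = 0\<^sub>m n m" using sym_matsD(1)[OF K'] by (intro mat_inner_self_eq_0) auto
    then show "K = 0\<^sub>m m m" using reg K by (simp add: regular_def)
  qed
  then have "alg_independent (coords m E) (\<lambda>c x. phi m E (?gram x) c)"
    using phi_poly_funs[OF graph _ gram gram_symmetric] finite_coords[OF graph]
    by (intro submersion_at_imp_alg_independent[of _ ?I]) auto
  then show ?thesis by (simp only: alg_independent_phi)
qed

section \<open>Symmetric matrices of bounded rank\<close>

lemma rank_mult_le_inner_dim:
  fixes A B :: "'a :: field mat"
  assumes "A \<in> carrier_mat m n" "B \<in> carrier_mat n nc"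
  shows "vec_space.rank m (A * B) \<le> n"
  using assms
proof (induction n arbitrary: A B)
  case 0
  then have "A * B = 0\<^sub>m m nc" by (intro eq_matI) (auto simp: scalar_prod_def)
  then show ?case by (simp add: vec_space.rank_0I)
next
  case (Suc n)
  let ?A = "mat m n (\<lambda>z. A $$ z)" and ?B = "mat n nc (\<lambda>z. B $$ z)"
    and ?R = "mat m nc (\<lambda>(i, j). A $$ (i, n) * B $$ (n, j))"
  have "A * B = ?A * ?B + ?R" using Suc.prems by (intro eq_matI) (auto simp: scalar_prod_def)
  moreover have "vec_space.rank m (?A * ?B + ?R) \<le> vec_space.rank m (?A * ?B) + vec_space.rank m ?R"
    by (rule vec_space.rank_subadditive) auto
  moreover have "vec_space.rank m ?R \<le> 1"
    by (rule vec_space.rank_le_1_product_entries[of _ _ _ "\<lambda>i. A $$ (i, n)" "\<lambda>j. B $$ (n, j)"]) auto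
  moreover have "vec_space.rank m (?A * ?B) \<le> n" by (rule Suc.IH) auto
  ultimately show ?case by simp
qed

lemma gram_sym_rank_le:
  assumes "P \<in> carrier_mat n m"
  shows "P\<^sup>T * P \<in> sym_rank_le m n"
  using gram_sym[OF assms] rank_mult_le_inner_dim[of "P\<^sup>T" m n P m] assms
  by (simp add: sym_rank_le_def)

lemma (in vec_space) rank_le_imp_spanning_cols:
  assumes A: "A \<in> carrier_mat n nc" and rank: "rank A \<le> r"
  obtains S where "S \<subseteq> set (cols A)" "card S \<le> r" "set (cols A) \<subseteq> span S"
proof -
  have cols: "set (cols A) \<subseteq> carrier_vec n" using A cols_dim by blast
  obtain S where S: "maximal S (\<lambda>T. T \<subseteq> set (cols A) \<and> lin_indpt T)"
    using maximal_exists_superset[of "set (cols A)" "\<lambda>T. T \<subseteq> set (cols A) \<and> lin_indpt T" "{}"]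
      finite_lin_indpt2 by auto
  then have S_indpt: "S \<subseteq> set (cols A)" "lin_indpt S" by (auto simp: maximal_def)
  have "v \<in> span S" if v: "v \<in> set (cols A)" for v
  proof (rule ccontr)
    assume not_in_span: "v \<notin> span S"
    have carrier: "S \<subseteq> carrier_vec n" "v \<in> carrier_vec n" using S_indpt(1) cols v by auto
    have "v \<notin> S" using not_in_span span_mem[OF carrier(1)] by auto
    then have "lin_indpt (insert v S)"
      using lin_dep_iff_in_span[of S v] carrier S_indpt(2) not_in_span by auto
    then have "insert v S = S" using S v S_indpt(1) unfolding maximal_def by blast
    then show False using \<open>v \<notin> S\<close> by auto
  qed
  then show ?thesis using that[OF S_indpt(1)] rank_card_indpt[OF A S] rank by auto
qed

lemma rank_le_imp_spanning_column_indices: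
  fixes A :: "'a :: field mat"
  assumes A: "A \<in> carrier_mat m nc" and rank: "vec_space.rank m A \<le> r"
  obtains D a where "D \<subseteq> {..<nc}" "card D \<le> r"
    "\<And>i j. i < m \<Longrightarrow> j < nc \<Longrightarrow> A $$ (i, j) = (\<Sum>d\<in>D. A $$ (i, d) * a d j)"
proof -
  interpret vec_space "TYPE('a)" m .
  have cols: "set (cols A) = col A ` {..<nc}" "set (cols A) \<subseteq> carrier_vec m"
    using A cols_dim[of A] by (auto simp: cols_def)
  obtain S where S: "S \<subseteq> set (cols A)" "card S \<le> r" "set (cols A) \<subseteq> span S"
    by (rule rank_le_imp_spanning_cols[OF A rank])
  obtain D where D: "D \<subseteq> {..<nc}" "S = col A ` D" "inj_on (col A) D"
    using S(1) unfolding cols(1) subset_image_inj by blast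
  have finS: "finite S" using S(1) finite_subset by blast
  have "\<exists>a. \<forall>i<m. A $$ (i, j) = (\<Sum>d\<in>D. A $$ (i, d) * a d)" if j: "j < nc" for j
  proof -
    have "col A j \<in> span S" using S(3) cols(1) j by auto
    moreover have "S \<subseteq> carrier_vec m" using S(1) cols(2) by blast
    ultimately have "\<exists>a. lincomb a S = col A j" using finite_in_span[OF finS, of "col A j"] by simp
    then obtain a where a: "lincomb a S = col A j" by (elim exE)
    have "A $$ (i, j) = (\<Sum>d\<in>D. A $$ (i, d) * a (col A d))" if i: "i < m" for i
    proof -
      have "A $$ (i, j) = lincomb a S $ i" using a i j A by (simp add: a)
      also have "\<dots> = (\<Sum>w\<in>S. a w * w $ i)" using S(1) cols(2) by (intro lincomb_index i) auto
      also have "\<dots> = (\<Sum>d\<in>D. a (col A d) * col A d $ i)" by (simp add: D(2) sum.reindex[OF D(3)])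
      also have "\<dots> = (\<Sum>d\<in>D. A $$ (i, d) * a (col A d))"
      proof (rule sum.cong[OF refl])
        fix d assume "d \<in> D"
        then have "d < nc" using D(1) by blast
        then show "a (col A d) * col A d $ i = A $$ (i, d) * a (col A d)" using i A by simp
      qed
      finally show ?thesis .
    qed
    then show ?thesis by (intro exI[of _ "\<lambda>d. a (col A d)"]) simp
  qed
  then have "\<forall>j\<in>{..<nc}. \<exists>a. \<forall>i<m. A $$ (i, j) = (\<Sum>d\<in>D. A $$ (i, d) * a d)" by blast
  from bchoice[OF this] obtain a
    where a: "\<forall>j\<in>{..<nc}. \<forall>i<m. A $$ (i, j) = (\<Sum>d\<in>D. A $$ (i, d) * a j d)" by blast
  have "card D \<le> r" using S(2) D(2,3) by (simp add: card_image)
  then show ?thesis by (rule that[of D "\<lambda>d j. a j d", OF D(1)]) (use a in blast)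
qed

lemma rank_le_imp_column_factorization:
  fixes A :: "'a :: field mat"
  assumes A: "A \<in> carrier_mat m nc" and rank: "vec_space.rank m A \<le> n"
  obtains C R where "C \<in> carrier_mat nc n" "R \<in> carrier_mat n nc" "A = A * C * R"
proof -
  obtain D a where D: "D \<subseteq> {..<nc}" "card D \<le> n"
    and a: "\<And>i j. i < m \<Longrightarrow> j < nc \<Longrightarrow> A $$ (i, j) = (\<Sum>d\<in>D. A $$ (i, d) * a d j)"
    by (rule rank_le_imp_spanning_column_indices[OF A rank]) blast
  obtain b where b: "bij_betw b {..<card D} D"
    using ex_bij_betw_nat_finite[of D] D(1) finite_subset by (auto simp: atLeast0LessThan)
  define C where "C = mat nc n (\<lambda>(i, k). if k < card D \<and> i = b k then 1 else 0 :: 'a)"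
  define R where "R = mat n nc (\<lambda>(k, j). if k < card D then a (b k) j else 0)"
  have AC: "(A * C) $$ (i, k) = A $$ (i, b k)" if "i < m" "k < card D" for i k
  proof -
    have "b k < nc" using b D(1) that(2) by (auto simp: bij_betw_def)
    then show ?thesis
      using that A D(2) by (simp add: C_def scalar_prod_def if_distrib sum.delta cong: if_cong)
  qed
  have "A = A * C * R"
  proof (rule eq_matI)
    fix i j assume "i < dim_row (A * C * R)" "j < dim_col (A * C * R)"
    then have ij: "i < m" "j < nc" using A by (auto simp: R_def)
    have "A $$ (i, j) = (\<Sum>d\<in>D. A $$ (i, d) * a d j)" by (rule a[OF ij])
    also have "\<dots> = (\<Sum>k<card D. A $$ (i, b k) * a (b k) j)"
      by (rule sum.reindex_bij_betw[OF b, symmetric])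
    also have "\<dots> = (\<Sum>k<card D. (A * C) $$ (i, k) * R $$ (k, j))"
      using ij D(2) by (intro sum.cong) (auto simp: AC R_def)
    also have "\<dots> = (\<Sum>k<n. (A * C) $$ (i, k) * R $$ (k, j))"
      using ij D(2) by (intro sum.mono_neutral_left) (auto simp: R_def)
    also have "\<dots> = (A * C * R) $$ (i, j)"
      using ij A by (simp add: C_def R_def scalar_prod_def lessThan_atLeast0)
    finally show "A $$ (i, j) = (A * C * R) $$ (i, j)" .
  qed (use A in \<open>auto simp: C_def R_def\<close>)
  then show ?thesis by (intro that[of C R]) (simp_all add: C_def R_def)
qed

text \<open>The variables \<open>x\<close> list the entries of an \<open>n \<times> m\<close> matrix \<open>P\<close> and of an \<open>n \<times> n\<close> matrix \<open>M\<close>,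
  which is symmetrised so that its entries are unconstrained.\<close>

definition param_data :: "nat \<Rightarrow> nat \<Rightarrow> (nat \<times> nat + nat \<times> nat \<Rightarrow> real) \<Rightarrow> real mat" where
  "param_data m n x = mat n m (\<lambda>z. x (Inl z))"

definition param_core :: "nat \<Rightarrow> (nat \<times> nat + nat \<times> nat \<Rightarrow> real) \<Rightarrow> real mat" where
  "param_core n x = mat n n (\<lambda>z. x (Inr z)) + (mat n n (\<lambda>z. x (Inr z)))\<^sup>T"

definition sym_param :: "nat \<Rightarrow> nat \<Rightarrow> (nat \<times> nat + nat \<times> nat \<Rightarrow> real) \<Rightarrow> real mat" where
  "sym_param m n x = (param_data m n x)\<^sup>T * param_core n x * param_data m n x"

definition sym_param_vars :: "nat \<Rightarrow> nat \<Rightarrow> (nat \<times> nat + nat \<times> nat) set" where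
  "sym_param_vars m n = ({..<n} \<times> {..<m}) <+> ({..<n} \<times> {..<n})"

lemma param_data_carrier: "param_data m n x \<in> carrier_mat n m"
  by (simp add: param_data_def)

lemma param_core_sym: "param_core n x \<in> sym_mats n"
  unfolding param_core_def sym_mats_def by (auto intro!: eq_matI)

lemma sym_param_sym: "sym_param m n x \<in> sym_mats m"
  unfolding sym_param_def by (rule sym_mats_congruence[OF param_core_sym param_data_carrier])

lemma sym_param_poly_mats: "sym_param m n \<in> poly_mats (sym_param_vars m n) m m"
proof -
  have P: "param_data m n \<in> poly_mats (sym_param_vars m n) n m"
    unfolding param_data_def[abs_def] by (rule poly_mats_coords) (auto simp: sym_param_vars_def)
  have "(\<lambda>x. mat n n (\<lambda>z. x (Inr z))) \<in> poly_mats (sym_param_vars m n) n n"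
    by (rule poly_mats_coords) (auto simp: sym_param_vars_def)
  then have N: "param_core n \<in> poly_mats (sym_param_vars m n) n n"
    unfolding param_core_def[abs_def] by (intro poly_mats_add poly_mats_transpose)
  show ?thesis
    unfolding sym_param_def[abs_def]
    by (rule poly_mats_mult[OF poly_mats_mult[OF poly_mats_transpose[OF P] N] P])
qed

lemma sym_rank_le_subset_range_sym_param: "sym_rank_le m n \<subseteq> range (sym_param m n)"
proof
  fix A assume "A \<in> sym_rank_le m n"
  then have A: "A \<in> carrier_mat m m" "A\<^sup>T = A" and rank: "vec_space.rank m A \<le> n"
    by (auto simp: sym_rank_le_def sym_mats_def)
  obtain C R where C: "C \<in> carrier_mat m n" and R: "R \<in> carrier_mat n m" and ACR: "A = A * C * R"
    by (rule rank_le_imp_column_factorization[OF A(1) rank])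
  define M where "M = (1/2) \<cdot>\<^sub>m (C\<^sup>T * A * C)"
  have core_sym: "C\<^sup>T * A * C \<in> sym_mats n"
    by (rule sym_mats_congruence[OF _ C]) (simp add: A sym_mats_def)
  then have M: "M \<in> carrier_mat n n" "M + M\<^sup>T = C\<^sup>T * A * C"
    using C sym_mats_entry[OF core_sym] by (auto simp: M_def intro!: eq_matI)
  have "A = R\<^sup>T * (C\<^sup>T * A)"
    using arg_cong[OF ACR, of transpose_mat] A C R
      transpose_mult[of "A * C" m n R m] transpose_mult[OF A(1) C] by simp
  also have "C\<^sup>T * A = C\<^sup>T * (A * C * R)" using ACR by simp
  also have "\<dots> = C\<^sup>T * (A * C) * R" using A C R by (intro assoc_mult_mat[symmetric]) auto
  also have "C\<^sup>T * (A * C) = C\<^sup>T * A * C" using A C by (intro assoc_mult_mat[symmetric]) auto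
  also have "R\<^sup>T * (C\<^sup>T * A * C * R) = R\<^sup>T * (C\<^sup>T * A * C) * R"
    using A C R by (intro assoc_mult_mat[symmetric]) auto
  also have "\<dots> = sym_param m n (case_sum (\<lambda>z. R $$ z) (\<lambda>z. M $$ z))"
  proof -
    have "mat n m (\<lambda>z. R $$ z) = R" "mat n n (\<lambda>z. M $$ z) = M"
      using R M(1) by (auto intro!: eq_matI)
    then show ?thesis by (simp add: sym_param_def param_data_def param_core_def M(2))
  qed
  finally show "A \<in> range (sym_param m n)" by blast
qed

lemma mat_inner_congruence_line:
  assumes K: "K \<in> sym_mats m" and P: "P \<in> carrier_mat n m" "P * K = 0\<^sub>m n m"
    and W: "W \<in> carrier_mat n m" and N: "N \<in> carrier_mat n n"
  shows "mat_inner m m K ((P + s \<cdot>\<^sub>m W)\<^sup>T * N * (P + s \<cdot>\<^sub>m W)) =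
    s\<^sup>2 * mat_inner n m W (N * (W * K))"
proof -
  note K = sym_matsD[OF K]
  let ?Q = "P + s \<cdot>\<^sub>m W"
  have Q: "?Q \<in> carrier_mat n m" "W * K \<in> carrier_mat n m" using P W K(1) by simp_all
  have QK: "?Q * K = s \<cdot>\<^sub>m (W * K)"
    using P W K(1) by (simp add: add_mult_distrib_mat[of _ n m] mult_smult_assoc_mat[of _ n m])
  have "mat_inner m m K (?Q\<^sup>T * N * ?Q) = mat_inner n m (?Q * K) (N * ?Q)"
    using mat_inner_mult_right[of "?Q\<^sup>T" m n "N * ?Q" m K] Q N K(1) by simp
  also have "\<dots> = s * mat_inner n m (W * K) (N * ?Q)"
    unfolding QK by (rule mat_inner_smult_left[OF Q(2)])
  also have "mat_inner n m (W * K) (N * ?Q) = mat_inner n m W (N * (?Q * K))"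
    using mat_inner_mult_left[of W n m K m "N * ?Q"] W K Q N by simp
  also have "\<dots> = s * mat_inner n m W (N * (W * K))"
    unfolding QK using N Q(2)
    by (simp add: mult_smult_distrib[OF N Q(2)] mat_inner_smult_right[of _ n m])
  finally show ?thesis by (simp add: power2_eq_square)
qed

lemma dir_deriv_mat_inner_sym_param:
  assumes K: "K \<in> sym_mats m" and ker: "param_data m n x * K = 0\<^sub>m n m"
  shows "dir_deriv (\<lambda>x. mat_inner m m K (sym_param m n x)) x w = 0"
proof (rule dir_deriv_eqI)
  let ?P = "param_data m n x" and ?W = "param_data m n w" and ?xw = "\<lambda>s z. x z + s * w z"
  define a where "a y = mat_inner n m ?W (param_core n y * (?W * K))" for y
  have W: "?W \<in> carrier_mat n m" "?W * K \<in> carrier_mat n m"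
    using param_data_carrier sym_matsD(1)[OF K] by (auto intro: mult_carrier_mat)
  note core = sym_matsD(1)[OF param_core_sym]
  have NWK: "param_core n y * (?W * K) \<in> carrier_mat n m" for y
    by (rule mult_carrier_mat[OF core W(2)])
  have "mat_inner m m K (sym_param m n (?xw s)) = s\<^sup>2 * (a x + s * a w)" for s
  proof -
    have "param_core n (?xw s) = param_core n x + s \<cdot>\<^sub>m param_core n w"
      unfolding param_core_def by (rule eq_matI) (auto simp: algebra_simps)
    then have "a (?xw s) =
        mat_inner n m ?W (param_core n x * (?W * K) + s \<cdot>\<^sub>m (param_core n w * (?W * K)))"
      using add_mult_distrib_mat[OF core smult_carrier_mat[OF core] W(2)]
        mult_smult_assoc_mat[OF core W(2)] by (simp add: a_def)
    also have "\<dots> = a x + s * a w"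
      using mat_inner_add_right[OF NWK smult_carrier_mat[OF NWK]] mat_inner_smult_right[OF NWK]
      by (simp add: a_def)
    finally have "a (?xw s) = a x + s * a w" .
    moreover have "param_data m n (?xw s) = ?P + s \<cdot>\<^sub>m ?W"
      unfolding param_data_def by (rule mat_line)
    ultimately show ?thesis
      using mat_inner_congruence_line[OF K param_data_carrier ker W(1) core, of s "?xw s"]
      by (simp add: sym_param_def a_def)
  qed
  moreover have "((\<lambda>s. s\<^sup>2 * (a x + s * a w)) has_real_derivative 0) (at 0)"
    by (auto intro!: derivative_eq_intros)
  ultimately show "((\<lambda>s. mat_inner m m K (sym_param m n (?xw s))) has_real_derivative 0) (at 0)"
    by simp
qed

section \<open>Estimability and dimension\<close>

lemma sym_rank_le_dense_imp_generically_regular: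
  assumes graph: "simple_graph m E"
    and dense: "zariski_dense (coords m E) (phi m E ` sym_rank_le m n)"
  shows "generically ({..<n} \<times> {..<m}) (\<lambda>p. regular m E (mat n m p))"
proof -
  let ?A = "sym_param m n" and ?I = "sym_param_vars m n"
  have "alg_independent (coords m E) (\<lambda>c x. phi m E (?A x) c)"
    unfolding alg_independent_phi
    using dense by (rule zariski_dense_mono) (intro image_mono sym_rank_le_subset_range_sym_param)
  moreover have "finite ?I" by (simp add: sym_param_vars_def)
  ultimately have "generically ?I (submersion_at (coords m E) (\<lambda>c x. phi m E (?A x) c))"
    using phi_poly_funs[OF graph _ sym_param_poly_mats sym_param_sym] finite_coords[OF graph]
    by (intro alg_independent_imp_generically_submersion) auto
  then have "generically ?I (\<lambda>x. regular m E (param_data m n x))"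
  proof (rule generically_mono)
    fix x assume "submersion_at (coords m E) (\<lambda>c x. phi m E (?A x) c) x"
    then show "regular m E (param_data m n x)"
      unfolding submersion_at_phi_iff[OF graph sym_param_poly_mats sym_param_sym] regular_def
      using dir_deriv_mat_inner_sym_param[OF L_space_subset_sym_mats] by (simp add: param_data_def)
  qed
  then show ?thesis
    unfolding sym_param_vars_def by (rule generically_Inl) (simp add: param_data_def)
qed

lemma estimable_iff_dense:
  assumes graph: "simple_graph m E"
  shows "estimable m E n \<longleftrightarrow> zariski_dense (coords m E) (phi m E ` sym_rank_le m n)"
proof -
  have AE_regular: "estimable m E n \<longleftrightarrow>
      (AE p in PiM ({..<n} \<times> {..<m}) (\<lambda>_. lborel). regular m E (mat n m p))"
    unfolding estimable_def by (simp add: sme_exists_iff_regular[OF graph mat_carrier])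
  show ?thesis
  proof
    assume "estimable m E n"
    then obtain p where "regular m E (mat n m p)"
      unfolding AE_regular using AE_PiM_lborel_imp_ex[of "{..<n} \<times> {..<m}"] by blast
    then show "zariski_dense (coords m E) (phi m E ` sym_rank_le m n)"
      by (rule zariski_dense_mono[OF regular_imp_gram_dense[OF graph]])
        (auto intro!: gram_sym_rank_le)
  next
    assume "zariski_dense (coords m E) (phi m E ` sym_rank_le m n)"
    then show "estimable m E n"
      unfolding AE_regular
      by (intro generically_imp_AE sym_rank_le_dense_imp_generically_regular[OF graph]) simp_all
  qed
qed

theorem theorem6p3:
  fixes m :: nat and E :: "nat set set"
  assumes "simple_graph m E"
  shows "smt m E = graph_rank m E"
proof -
  have "estimable m E n \<longleftrightarrow>
      alg_dim (coords m E) (phi m E ` sym_rank_le m n) = enat (card {..<m} + card E)" for n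
  proof -
    have "phi m E ` sym_rank_le m n \<noteq> {}" using gram_sym_rank_le[OF zero_carrier_mat] by blast
    moreover have "phi m E ` sym_rank_le m n \<subseteq> coords m E \<rightarrow>\<^sub>E UNIV" by (auto simp: phi_def)
    ultimately show ?thesis
      using estimable_iff_dense[OF assms] alg_dim_eq_card_iff[OF finite_coords[OF assms]]
      by (simp add: card_coords[OF assms])
  qed
  then show ?thesis by (simp add: smt_def graph_rank_def)
qed

end
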